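(* There exists $N$ such that for every $n \ge N$ the following holds: if $G$ is a connected graph on $n$ vertices whose principal ratio $\gamma(G)$ is maximum among all connected graphs on $n$ vertices, then $G$ is a kite graph $P_r \cdot K_s$ for some $r,s$ (with $r+s-1=n$).
   Context: All graphs are simple and undirected. For a graph $G$, $Q(G)=D(G)+A(G)$ is the signless Laplacian, where $D(G)$ is the diagonal matrix of vertex degrees and $A(G)$ the adjacency matrix. For connected $G$, by Perron–Frobenius the largest eigenvalue $q_1(G)$ of $Q(G)$ has a positive eigenvector $\mathbf{x}$ (unique up to scaling). The principal ratio is $\gamma(G)=x_{\max}/x_{\min}$, where $x_{\max}$ and $x_{\min}$ are the largest and smallest entries of $\mathbf{x}$. The kite graph $P_r\cdot K_s$ is obtained by identifying an end vertex of the path $P_r$ (on $r$ vertices) with a vertex of the complete graph $K_s$. *)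

theory Defs
  imports "Graph_Theory.Graph_Theory" "Jordan_Normal_Form.Spectral_Radius"
begin

text \<open>
  A simple undirected graph is a symmetric, loop-free pair digraph (locale \<open>pair_graph\<close>).
  Graphs on \<open>n\<close> vertices are labelled by \<open>0, \<dots>, n - 1\<close>, so that vertices index the rows
  and columns of the associated matrices; in general graphs are compared by \<open>digraph_iso\<close>.
\<close>

definition connected_graphs :: "nat \<Rightarrow> nat pair_pre_digraph set" where
  "connected_graphs n =
    {G. pair_graph G \<and> pverts G = {0..<n} \<and> Digraph_Component.connected (with_proj G)}"

text \<open>The matrices below are meaningful when the vertex set is \<open>{0..<card (pverts G)}\<close>.\<close>

definition adjacency_matrix :: "nat pair_pre_digraph \<Rightarrow> real mat" where
  "adjacency_matrix G =
    mat (card (pverts G)) (card (pverts G)) (\<lambda>(i, j). if (i, j) \<in> parcs G then 1 else 0)"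

text \<open>Each edge \<open>uv\<close> is represented by the two arcs \<open>(u, v)\<close> and \<open>(v, u)\<close>, so the degree of
  a vertex in the undirected graph is its out-degree.\<close>

definition degree_matrix :: "nat pair_pre_digraph \<Rightarrow> real mat" where
  "degree_matrix G =
    mat (card (pverts G)) (card (pverts G))
      (\<lambda>(i, j). if i = j then real (out_degree (with_proj G) i) else 0)"

definition signless_laplacian :: "nat pair_pre_digraph \<Rightarrow> real mat" where
  "signless_laplacian G = degree_matrix G + adjacency_matrix G"

definition largest_eigenvalue :: "nat pair_pre_digraph \<Rightarrow> real" where
  "largest_eigenvalue G = Max (spectrum (signless_laplacian G))"

definition perron_vector :: "nat pair_pre_digraph \<Rightarrow> real vec \<Rightarrow> bool" where
  "perron_vector G x \<longleftrightarrow>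
    eigenvector (signless_laplacian G) x (largest_eigenvalue G) \<and> (\<forall>a \<in> set\<^sub>v x. a > 0)"

text \<open>For connected graphs the Perron vector exists and is unique up to scaling, so the ratio
  does not depend on the vector chosen here.\<close>

definition principal_ratio :: "nat pair_pre_digraph \<Rightarrow> real" where
  "principal_ratio G = (let x = (SOME x. perron_vector G x) in Max (set\<^sub>v x) / Min (set\<^sub>v x))"

definition complete_arcs :: "nat set \<Rightarrow> nat rel" where
  "complete_arcs S = {(u, v). u \<in> S \<and> v \<in> S \<and> u \<noteq> v}"

definition path_arcs :: "nat set \<Rightarrow> nat rel" where
  "path_arcs S = {(u, v). u \<in> S \<and> v \<in> S \<and> (v = Suc u \<or> u = Suc v)}"

text \<open>The path on \<open>0, \<dots>, r - 1\<close> and the complete graph on the \<open>s\<close> vertices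
  \<open>r - 1, \<dots>, r + s - 2\<close> share exactly the vertex \<open>r - 1\<close>, an end of the path (\<open>r, s \<ge> 1\<close>).\<close>

definition kite :: "nat \<Rightarrow> nat \<Rightarrow> nat pair_pre_digraph" where
  "kite r s =
    \<lparr> pverts = {0..<r} \<union> {r - 1..<r + s - 1},
      parcs = path_arcs {0..<r} \<union> complete_arcs {r - 1..<r + s - 1} \<rparr>"

end

theory Submission
  imports Defs "HOL-Analysis.Function_Topology" "HOL-Real_Asymp.Real_Asymp"
begin

text \<open>
  Let \<open>x\<close> be a Perron vector with maximal entry \<open>1\<close>, let \<open>p 0, \<dots>, p L\<close> be a shortest path from
  a vertex with minimal entry to a vertex with entry \<open>1\<close>, and let \<open>S\<close> be the set of the \<open>M\<close> remaining
  vertices. Along the path the entries grow at most as on a pendant path, with equality for kites.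
  Comparing with the kite \<open>P\<^bsub>L+1\<^esub> \<cdot> K\<^bsub>M+1\<^esub>\<close> shows that \<open>q > 2 M\<close> in an extremal graph, which forces
  \<open>p L\<close> to be adjacent to all of \<open>S\<close>; hence only the two path vertices before \<open>p L\<close> can have further
  neighbours in \<open>S\<close>. Comparisons with \<open>P\<^bsub>L+2\<^esub> \<cdot> K\<^bsub>M\<^esub>\<close> and \<open>P\<^bsub>L\<^esub> \<cdot> K\<^bsub>M+2\<^esub>\<close> show that \<open>L / M\<close> is large and
  that the entry of \<open>p (L - 1)\<close> is small, so \<open>S \<union> {p L}\<close> is nearly a clique with all entries at least
  \<open>1 / 2\<close>. Then every edge between \<open>S\<close> and \<open>p (L - 2)\<close> or \<open>p (L - 1)\<close> costs a constant factor of the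
  ratio, while the gain through \<open>q\<close> is only \<open>1 + o(1)\<close> per edge. So there are no such edges, the graph
  is a subgraph of \<open>P\<^bsub>L+1\<^esub> \<cdot> K\<^bsub>M+1\<^esub>\<close>, and as its eigenvalue is not smaller it equals this kite.
\<close>

section \<open>Growth along a pendant path\<close>

text \<open>If \<open>v\<^sub>0, v\<^sub>1, \<dots>\<close> is a pendant path with end vertex \<open>v\<^sub>0\<close>, then \<open>growth q i\<close> is the ratio of the
  eigenvector entries at \<open>v\<^bsub>i+1\<^esub>\<close> and \<open>v\<^sub>i\<close>.\<close>

primrec growth :: "real \<Rightarrow> nat \<Rightarrow> real" where
  "growth q 0 = q - 1"
| "growth q (Suc i) = q - 2 - 1 / growth q i"

definition path_growth :: "real \<Rightarrow> nat \<Rightarrow> real" where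
  "path_growth q k = (\<Prod>i<k. growth q i)"

lemma path_growth_0 [simp]: "path_growth q 0 = 1"
  by (simp add: path_growth_def)

lemma path_growth_Suc [simp]: "path_growth q (Suc k) = path_growth q k * growth q k"
  by (simp add: path_growth_def)

lemma growth_ge: "4 \<le> q \<Longrightarrow> q - 3 \<le> growth q i"
proof (induction i)
  case (Suc i)
  then have "1 / growth q i \<le> 1" by (simp add: divide_le_eq)
  then show ?case by simp
qed simp

lemma growth_pos: "4 \<le> q \<Longrightarrow> 0 < growth q i"
  using growth_ge[of q i] by linarith

lemma growth_le: "4 \<le> q \<Longrightarrow> growth q i \<le> q - 1"
proof (cases i)
  case (Suc j)
  assume "4 \<le> q"
  then have "0 \<le> 1 / growth q j" using growth_pos[of q j] by simp
  with Suc show ?thesis by (simp only: growth.simps)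
qed simp

text \<open>The subtracted reciprocal shrinks as \<open>q\<close> grows, so each step of the
  recursion keeps at least the gain of \<open>q - 2\<close>.\<close>

lemma growth_add_le:
  assumes "4 \<le> q" "q \<le> q'"
  shows "growth q i + (q' - q) \<le> growth q' i"
proof (induction i)
  case (Suc i)
  have "growth q i \<le> growth q' i" using Suc assms by linarith
  then have "1 / growth q' i \<le> 1 / growth q i"
    using growth_pos[OF assms(1), of i] by (intro divide_left_mono) auto
  then show ?case by (simp only: growth.simps)
qed simp

text \<open>With \<open>growth q (Suc i) = (q - 3) + (1 - 1 / growth q i)\<close> the claim reduces
  to \<open>(q - 3) * (1 - 1 / r') \<le> (q' - 3) * (1 - 1 / r)\<close>. The induction hypothesis
  bounds \<open>1 / r'\<close> from below, and \<open>5 \<le> q\<close> gives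
  \<open>2 \<le> r\<close>, which pays for the remaining term.\<close>

lemma growth_mult_le:
  assumes "5 \<le> q" "q \<le> q'"
  shows "growth q' i * (q - 3) \<le> growth q i * (q' - 3)"
proof (induction i)
  case 0
  then show ?case using assms by (simp add: algebra_simps)
next
  case (Suc i)
  define r r' where "r = growth q i" and "r' = growth q' i"
  have r: "2 \<le> r" "0 < r'" using growth_ge[of q i] growth_pos[of q' i] assms unfolding r_def r'_def by auto
  have IH: "r' * (q - 3) \<le> r * (q' - 3)" using Suc by (simp add: r_def r'_def)
  have "(q - 3) / (r * (q' - 3)) \<le> 1 / r'"
    using IH r assms by (simp add: field_simps)
  then have "(q - 3) * ((q - 3) / (r * (q' - 3))) \<le> (q - 3) * (1 / r')"
    using assms by (intro mult_left_mono) auto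
  moreover have "(q - 3) - (q - 3) * ((q - 3) / (r * (q' - 3))) \<le> (q' - 3) * (1 - 1 / r)"
  proof -
    have "(q' - 3) * (1 - 1 / r) - ((q - 3) - (q - 3) * ((q - 3) / (r * (q' - 3))))
       = (q' - q) * (r * (q' - 3) - ((q' - 3) + (q - 3))) / (r * (q' - 3))"
      using r assms by (simp add: field_simps)
    moreover have "0 \<le> r * (q' - 3) - ((q' - 3) + (q - 3))"
    proof -
      have "2 * (q' - 3) \<le> r * (q' - 3)" using r assms by (intro mult_right_mono) auto
      moreover have "(q' - 3) + (q - 3) \<le> 2 * (q' - 3)" using assms by simp
      ultimately show ?thesis by (simp only: diff_ge_0_iff_ge order_trans)
    qed
    ultimately have "0 \<le> (q' - 3) * (1 - 1 / r) - ((q - 3) - (q - 3) * ((q - 3) / (r * (q' - 3))))"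
      using r assms by (simp only:) (intro divide_nonneg_nonneg mult_nonneg_nonneg, auto)
    then show ?thesis by linarith
  qed
  ultimately have "(q - 3) * (1 - 1 / r') \<le> (q' - 3) * (1 - 1 / r)"
    by (simp only: right_diff_distrib mult_1_right)
  moreover have "growth q' (Suc i) * (q - 3) = (q' - 3) * (q - 3) + (q - 3) * (1 - 1 / r')"
    by (simp add: r'_def algebra_simps)
  moreover have "growth q (Suc i) * (q' - 3) = (q' - 3) * (q - 3) + (q' - 3) * (1 - 1 / r)"
    by (simp add: r_def algebra_simps)
  ultimately show ?case by linarith
qed

lemma path_growth_pos: "4 \<le> q \<Longrightarrow> 0 < path_growth q k"
  unfolding path_growth_def by (intro prod_pos ballI growth_pos)

lemma path_growth_ge: "4 \<le> q \<Longrightarrow> (q - 3) ^ k \<le> path_growth q k"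
  using prod_mono[of "{..<k}" "\<lambda>_. q - 3" "growth q"] growth_ge[of q]
  by (simp add: path_growth_def)

text \<open>Since \<open>growth q i \<le> q\<close>, the additive gain \<open>q' - q\<close> in each
  factor is at least the relative gain \<open>q' / q\<close>. This bounds from below what a larger
  eigenvalue adds to the ratio.\<close>

lemma path_growth_scale_le:
  assumes "4 \<le> q" "q \<le> q'"
  shows "path_growth q k * (q' / q) ^ k \<le> path_growth q' k"
proof -
  have "growth q i * (q' / q) \<le> growth q' i" for i
  proof -
    have "growth q i * ((q' - q) / q) \<le> q * ((q' - q) / q)"
      using growth_le[OF assms(1), of i] assms by (intro mult_right_mono) auto
    then have "growth q i * ((q' - q) / q) \<le> q' - q" using assms by simp
    moreover have "growth q i * (q' / q) = growth q i + growth q i * ((q' - q) / q)"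
      using assms by (simp add: field_simps)
    ultimately show ?thesis using growth_add_le[OF assms, of i] by linarith
  qed
  then have "(\<Prod>i<k. growth q i * (q' / q)) \<le> (\<Prod>i<k. growth q' i)"
    using growth_pos[OF assms(1)] assms by (intro prod_mono) (auto simp: less_imp_le)
  then show ?thesis by (simp only: path_growth_def prod.distrib prod_constant card_lessThan)
qed

lemma path_growth_mono:
  assumes "4 \<le> q" "q \<le> q'"
  shows "path_growth q k \<le> path_growth q' k"
proof -
  have "growth q i \<le> growth q' i" for i using growth_add_le[OF assms, of i] assms by linarith
  then show ?thesis unfolding path_growth_def
    using growth_pos[OF assms(1)] by (intro prod_mono) (auto simp: less_imp_le)
qed

lemma path_growth_strict_mono:
  assumes "4 \<le> q" "q < q'" "0 < k"
  shows "path_growth q k < path_growth q' k"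
proof -
  have "1 < (q' / q) ^ k" using assms by (intro one_less_power) auto
  then have "path_growth q k * 1 < path_growth q k * (q' / q) ^ k"
    using path_growth_pos[OF assms(1)] by (intro mult_strict_left_mono) auto
  then show ?thesis using path_growth_scale_le[of q q' k] assms by simp
qed

text \<open>Factor by factor from \<open>growth_mult_le\<close>; it bounds from above what a larger
  eigenvalue can add to the ratio.\<close>

lemma path_growth_le_scale:
  assumes "5 \<le> q" "q \<le> q'"
  shows "path_growth q' k \<le> path_growth q k * ((q' - 3) / (q - 3)) ^ k"
proof -
  have "growth q' i \<le> growth q i * ((q' - 3) / (q - 3))" for i
    using growth_mult_le[OF assms, of i] assms by (simp add: field_simps)
  then have "(\<Prod>i<k. growth q' i) \<le> (\<Prod>i<k. growth q i * ((q' - 3) / (q - 3)))"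
    using growth_pos[of q'] assms by (intro prod_mono) (auto simp: less_imp_le)
  then show ?thesis by (simp only: path_growth_def prod.distrib prod_constant card_lessThan)
qed

lemma power_ratio_le_exp:
  fixes a t :: real
  assumes "0 < a" "0 \<le> t"
  shows "((a + t) / a) ^ k \<le> exp (k * t / a)"
proof -
  have "(a + t) / a = 1 + t / a" using assms by (simp add: field_simps)
  also have "\<dots> \<le> exp (t / a)" by (rule exp_ge_add_one_self)
  finally have "((a + t) / a) ^ k \<le> exp (t / a) ^ k" using assms by (intro power_mono) auto
  then show ?thesis by (simp add: exp_of_nat_mult[symmetric])
qed

section \<open>Positive eigenvectors of the signless Laplacian\<close>

lemma sum_arcs_fst:
  fixes g :: "'a \<Rightarrow> 'a \<Rightarrow> real"
  assumes "finite E"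
  shows "(\<Sum>(a,b)\<in>E. if a = v then g a b else 0) = (\<Sum>b\<in>E `` {v}. g v b)"
proof -
  have "(\<Sum>(a,b)\<in>E. if a = v then g a b else 0) = (\<Sum>(a,b)\<in>{e\<in>E. fst e = v}. g a b)"
    using assms by (intro sum.mono_neutral_cong_right) (auto split: if_splits)
  also have "\<dots> = (\<Sum>b\<in>E `` {v}. g v b)"
    by (rule sum.reindex_bij_witness[of _ "\<lambda>b. (v, b)" snd]) auto
  finally show ?thesis .
qed

lemma sum_arcs_snd:
  fixes g :: "'a \<Rightarrow> 'a \<Rightarrow> real"
  assumes "finite E" "sym E"
  shows "(\<Sum>(a,b)\<in>E. if b = v then g a b else 0) = (\<Sum>a\<in>E `` {v}. g a v)"
proof -
  have "(\<Sum>(a,b)\<in>E. if b = v then g a b else 0) = (\<Sum>(a,b)\<in>{e\<in>E. snd e = v}. g a b)"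
    using assms by (intro sum.mono_neutral_cong_right) (auto split: if_splits)
  also have "\<dots> = (\<Sum>a\<in>E `` {v}. g a v)"
    using assms by (intro sum.reindex_bij_witness[of _ "\<lambda>b. (b, v)" fst]) (auto dest: symD)
  finally show ?thesis .
qed

text \<open>First-order condition at a maximum: if \<open>c\<close> were nonzero, the linear term
  would win for small \<open>t\<close> with the sign of \<open>c\<close>.\<close>

lemma linear_le_quadratic_imp_zero:
  fixes c d :: real
  assumes "\<And>t. t * c \<le> t\<^sup>2 * d"
  shows "c = 0"
proof (rule ccontr)
  assume c: "c \<noteq> 0"
  define e where "e = \<bar>d\<bar> + 1"
  have "c / e * c \<le> (c / e)\<^sup>2 * d" by (rule assms)
  also have "\<dots> \<le> (c / e)\<^sup>2 * \<bar>d\<bar>" by (intro mult_left_mono) auto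
  finally have "c\<^sup>2 / e * e\<^sup>2 \<le> (c\<^sup>2 / e\<^sup>2 * \<bar>d\<bar>) * e\<^sup>2"
    by (intro mult_right_mono) (simp_all add: power2_eq_square)
  then have "c\<^sup>2 * e \<le> c\<^sup>2 * \<bar>d\<bar>" by (simp add: e_def power2_eq_square split: if_splits)
  then have "e \<le> \<bar>d\<bar>" using c by simp
  then show False by (simp add: e_def)
qed

text \<open>Compactness gives a maximizer among nonnegative unit vectors. It is maximal for all
  \<open>y\<close>, because replacing \<open>y\<close> by its normalized absolute value does not
  decrease the Rayleigh quotient.\<close>

lemma signless_form_has_maximizer:
  fixes V :: "'a set" and E :: "('a \<times> 'a) set"
  assumes "finite V" "V \<noteq> {}" "E \<subseteq> V \<times> V"
  obtains x :: "'a \<Rightarrow> real" and m :: real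
  where "\<And>v. v \<in> V \<Longrightarrow> 0 \<le> x v" "(\<Sum>v\<in>V. (x v)\<^sup>2) = 1"
    "(\<Sum>(a,b)\<in>E. (x a + x b)\<^sup>2) = m"
    "\<And>y. (\<Sum>(a,b)\<in>E. (y a + y b)\<^sup>2) \<le> m * (\<Sum>v\<in>V. (y v)\<^sup>2)"
proof -
  \<comment> \<open>Coordinates outside \<open>V\<close> are pinned to 0, so that the product over
    the whole type is compact.\<close>
  define B where "B = (\<lambda>v. if v \<in> V then {0..1} else {0::real})"
  define N where "N = (\<lambda>y :: 'a \<Rightarrow> real. \<Sum>v\<in>V. (y v)\<^sup>2)"
  define R where "R = (\<lambda>y :: 'a \<Rightarrow> real. \<Sum>(a,b)\<in>E. (y a + y b)\<^sup>2)"
  define K where "K = Pi\<^sub>E UNIV B \<inter> {y. N y = 1}"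
  have finE: "finite E" using assms finite_subset by blast
  have "compactin (product_topology (\<lambda>_. euclidean) UNIV) (Pi\<^sub>E UNIV B)"
    by (subst compactin_PiE) (auto simp: B_def)
  then have "compact (Pi\<^sub>E UNIV B)"
    by (simp add: euclidean_product_topology)
  moreover have "closed {y. N y = 1}"
    unfolding N_def
    by (intro closed_Collect_eq continuous_intros continuous_on_product_coordinates)
  ultimately have "compact K" unfolding K_def by (rule compact_Int_closed)
  have unit: "(\<lambda>v. if v \<in> V then \<bar>y v\<bar> / sqrt (N y) else 0) \<in> K" if "0 < N y" for y
  proof -
    have "\<bar>y v\<bar> / sqrt (N y) \<le> 1" if "v \<in> V" for v
    proof -
      have "(y v)\<^sup>2 \<le> N y" unfolding N_def using assms that by (intro member_le_sum) auto
      then have "\<bar>y v\<bar> \<le> sqrt (N y)" by (simp add: real_le_rsqrt)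
      then show ?thesis using \<open>0 < N y\<close> by simp
    qed
    moreover have "(\<Sum>v\<in>V. (if v \<in> V then \<bar>y v\<bar> / sqrt (N y) else 0)\<^sup>2) = 1"
    proof -
      have "(\<Sum>v\<in>V. (if v \<in> V then \<bar>y v\<bar> / sqrt (N y) else 0)\<^sup>2) = (\<Sum>v\<in>V. (y v)\<^sup>2 / N y)"
        using that by (intro sum.cong) (auto simp: power_divide)
      also have "\<dots> = 1" using that by (simp add: N_def sum_divide_distrib[symmetric])
      finally show ?thesis .
    qed
    ultimately show ?thesis
      using that by (auto simp: K_def B_def N_def PiE_iff)
  qed
  have "N (\<lambda>_. 1) = card V" by (simp add: N_def)
  then have "0 < N (\<lambda>_. 1)" using assms by (simp add: card_gt_0_iff)
  then have "K \<noteq> {}" using unit by blast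
  moreover have "continuous_on K R" unfolding R_def case_prod_beta
    by (intro continuous_intros continuous_on_subset[OF continuous_on_product_coordinates]) auto
  ultimately obtain x where x: "x \<in> K" "\<And>y. y \<in> K \<Longrightarrow> R y \<le> R x"
    using continuous_attains_sup[OF \<open>compact K\<close>] by blast
  have "R y \<le> R x * N y" for y
  proof (cases "N y = 0")
    case True
    then have "\<And>v. v \<in> V \<Longrightarrow> y v = 0"
      unfolding N_def using assms by (subst (asm) sum_nonneg_eq_0_iff) auto
    then have "R y = 0" unfolding R_def using assms by (intro sum.neutral) auto
    with True show ?thesis by simp
  next
    case False
    moreover have "0 \<le> N y" unfolding N_def by (intro sum_nonneg) auto
    ultimately have N: "0 < N y" by simp
    define z where "z = (\<lambda>v. if v \<in> V then \<bar>y v\<bar> / sqrt (N y) else 0)"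
    have "R y \<le> N y * R z"
      unfolding R_def sum_distrib_left
    proof (intro sum_mono)
      fix e assume "e \<in> E"
      then obtain a b where e: "e = (a, b)" "a \<in> V" "b \<in> V" using assms by auto
      have "(y a + y b)\<^sup>2 \<le> (\<bar>y a\<bar> + \<bar>y b\<bar>)\<^sup>2" by (simp add: abs_le_square_iff[symmetric])
      also have "\<dots> = N y * ((\<bar>y a\<bar> + \<bar>y b\<bar>) / sqrt (N y))\<^sup>2"
        using N by (simp add: power_divide)
      finally show "(case e of (a, b) \<Rightarrow> (y a + y b)\<^sup>2) \<le> N y * (case e of (a, b) \<Rightarrow> (z a + z b)\<^sup>2)"
        using e by (simp add: z_def add_divide_distrib)
    qed
    also have "\<dots> \<le> N y * R x" using N x(2)[OF unit[OF N]] by (simp add: z_def)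
    finally show ?thesis by (simp add: mult.commute)
  qed
  moreover have "0 \<le> x v" if "v \<in> V" for v
  proof -
    have "x v \<in> B v" using x(1) by (auto simp: K_def)
    then show ?thesis using that by (simp add: B_def)
  qed
  moreover have "N x = 1" using x(1) by (simp add: K_def)
  ultimately show ?thesis using that[of x "R x"] by (simp add: N_def R_def)
qed

text \<open>Varying the maximizer in the direction of a single vertex yields the eigenvalue equation
  there. The eigenvalue is \<open>m / 2\<close>, since the form counts each edge once per
  arc.\<close>

lemma positive_signless_eigenvector:
  fixes V :: "'a set" and E :: "('a \<times> 'a) set"
  assumes "finite V" "V \<noteq> {}" "E \<subseteq> V \<times> V" "sym E"
    and conn: "\<And>u v. u \<in> V \<Longrightarrow> v \<in> V \<Longrightarrow> (u, v) \<in> E\<^sup>*"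
  obtains q :: real and x :: "'a \<Rightarrow> real"
  where "\<And>v. v \<in> V \<Longrightarrow> 0 < x v"
    "\<And>v. v \<in> V \<Longrightarrow> q * x v = (\<Sum>u\<in>E `` {v}. x v + x u)"
proof -
  obtain x :: "'a \<Rightarrow> real" and m :: real where x: "\<And>v. v \<in> V \<Longrightarrow> 0 \<le> x v" "(\<Sum>v\<in>V. (x v)\<^sup>2) = 1"
    "(\<Sum>(a,b)\<in>E. (x a + x b)\<^sup>2) = m"
    "\<And>y. (\<Sum>(a,b)\<in>E. (y a + y b)\<^sup>2) \<le> m * (\<Sum>v\<in>V. (y v)\<^sup>2)"
    using signless_form_has_maximizer[OF assms(1-3)] by metis
  have finE: "finite E" using assms finite_subset by blast
  have eq: "m / 2 * x v = (\<Sum>u\<in>E `` {v}. x v + x u)" if v: "v \<in> V" for v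
  proof -
    define h where "h = (\<lambda>u. if u = v then 1 else 0 :: real)"
    define C where "C = (\<Sum>u\<in>V. x u * h u)"
    define D where "D = (\<Sum>(a,b)\<in>E. (x a + x b) * (h a + h b))"
    define d where "d = m * (\<Sum>u\<in>V. (h u)\<^sup>2) - (\<Sum>(a,b)\<in>E. (h a + h b)\<^sup>2)"
    have "t * (2 * D - 2 * (m * C)) \<le> t\<^sup>2 * d" for t
    proof -
      have "(\<Sum>(a,b)\<in>E. ((x a + t * h a) + (x b + t * h b))\<^sup>2)
          = (\<Sum>(a,b)\<in>E. (x a + x b)\<^sup>2) + 2 * t * D + t\<^sup>2 * (\<Sum>(a,b)\<in>E. (h a + h b)\<^sup>2)"
        unfolding D_def sum_distrib_left sum.distrib[symmetric]
        by (intro sum.cong) (auto simp: power2_eq_square algebra_simps)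
      moreover have "(\<Sum>u\<in>V. (x u + t * h u)\<^sup>2)
          = (\<Sum>u\<in>V. (x u)\<^sup>2) + 2 * t * C + t\<^sup>2 * (\<Sum>u\<in>V. (h u)\<^sup>2)"
        unfolding C_def sum_distrib_left sum.distrib[symmetric]
        by (intro sum.cong) (auto simp: power2_eq_square algebra_simps)
      ultimately have "m + 2 * t * D + t\<^sup>2 * (\<Sum>(a,b)\<in>E. (h a + h b)\<^sup>2)
          \<le> m * (1 + 2 * t * C + t\<^sup>2 * (\<Sum>u\<in>V. (h u)\<^sup>2))"
        using x(4)[of "\<lambda>u. x u + t * h u"] x(2,3) by simp
      then show ?thesis by (simp add: d_def algebra_simps)
    qed
    then have "2 * D - 2 * (m * C) = 0" by (rule linear_le_quadratic_imp_zero)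
    then have "D = m * C" by simp
    moreover have "C = x v"
      using assms(1) v by (simp add: C_def h_def if_distrib cong: if_cong)
    moreover have "D = 2 * (\<Sum>u\<in>E `` {v}. x v + x u)"
    proof -
      have "D = (\<Sum>(a,b)\<in>E. if a = v then x a + x b else 0) + (\<Sum>(a,b)\<in>E. if b = v then x a + x b else 0)"
        unfolding D_def sum.distrib[symmetric] by (intro sum.cong) (auto simp: h_def)
      then show ?thesis
        using sum_arcs_fst[OF finE, of v "\<lambda>a b. x a + x b"]
          sum_arcs_snd[OF finE assms(4), of v "\<lambda>a b. x a + x b"] by (simp add: add.commute)
    qed
    ultimately show ?thesis by simp
  qed
  have "0 < x v" if v: "v \<in> V" for v
  proof (rule ccontr)
    assume "\<not> 0 < x v"
    then have "x v = 0" using x(1)[OF v] by simp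
    \<comment> \<open>At a zero entry the eigenvalue equation makes a sum of nonnegative entries
      vanish, so zeros spread to neighbours and, by connectivity, everywhere.\<close>
    have step: "x u = 0" if "x w = 0" "(w, u) \<in> E" for w u
    proof -
      have w: "w \<in> V" "E `` {w} \<subseteq> V" using that assms by auto
      then have "(\<Sum>u\<in>E `` {w}. x u) = 0" using eq[OF w(1)] that by simp
      then show ?thesis using w that x(1) assms(1)
        by (subst (asm) sum_nonneg_eq_0_iff) (auto intro: finite_subset)
    qed
    have "x u = 0" if "u \<in> V" for u
      using conn[OF v that] by (induction rule: rtrancl_induct) (use \<open>x v = 0\<close> step in auto)
    then show False using x(2) by simp
  qed
  with eq show ?thesis using that[of x "m / 2"] by blast
qed

text \<open>Scale a multiple of \<open>x\<close> until it touches \<open>\<bar>y\<bar>\<close> from above, and compare at a point of contact.\<close>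

lemma abs_eigenvalue_le_of_positive:
  fixes V :: "'a set" and A :: "'a \<Rightarrow> 'a \<Rightarrow> real"
  assumes V: "finite V" "V \<noteq> {}"
    and A: "\<And>i j. 0 \<le> A i j"
    and x: "\<And>i. i \<in> V \<Longrightarrow> 0 < x i" "\<And>i. i \<in> V \<Longrightarrow> q * x i = (\<Sum>j\<in>V. A i j * x j)"
    and y: "\<And>i. i \<in> V \<Longrightarrow> k * y i = (\<Sum>j\<in>V. A i j * y j)" "i0 \<in> V" "y i0 \<noteq> 0"
  shows "\<bar>k\<bar> \<le> q"
proof -
  define t where "t = Max ((\<lambda>i. \<bar>y i\<bar> / x i) ` V)"
  have le: "\<bar>y j\<bar> \<le> t * x j" if "j \<in> V" for j
  proof -
    have "\<bar>y j\<bar> / x j \<le> t" unfolding t_def using V that by (intro Max_ge) auto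
    then show ?thesis using x(1)[OF that] by (simp add: field_simps)
  qed
  have "t \<in> (\<lambda>i. \<bar>y i\<bar> / x i) ` V" unfolding t_def using V by (intro Max_in) auto
  then obtain i where i: "i \<in> V" "t = \<bar>y i\<bar> / x i" by blast
  then have yi: "\<bar>y i\<bar> = t * x i" using x(1)[OF i(1)] by simp
  have "0 < \<bar>y i0\<bar>" using y by simp
  then have "0 < t * x i0" using le[OF y(2)] by linarith
  then have "0 < t" using x(1)[OF y(2)] by (simp add: zero_less_mult_iff)
  then have pos: "0 < \<bar>y i\<bar>" using yi x(1)[OF i(1)] by simp
  have "\<bar>k\<bar> * \<bar>y i\<bar> = \<bar>\<Sum>j\<in>V. A i j * y j\<bar>" using y(1)[OF i(1)] by (simp add: abs_mult[symmetric])
  also have "\<dots> \<le> (\<Sum>j\<in>V. \<bar>A i j * y j\<bar>)" by (rule sum_abs)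
  also have "\<dots> \<le> (\<Sum>j\<in>V. A i j * (t * x j))"
    using A le by (intro sum_mono) (auto simp: abs_mult intro: mult_left_mono)
  also have "\<dots> = t * (q * x i)" unfolding x(2)[OF i(1)] sum_distrib_left
    by (intro sum.cong) auto
  also have "\<dots> = q * \<bar>y i\<bar>" using yi by simp
  finally show ?thesis using pos by simp
qed

section \<open>From matrices and digraphs to eigenvalue equations on relations\<close>

lemma connected_graphs_iff:
  "G \<in> connected_graphs n \<longleftrightarrow>
    pverts G = {0..<n} \<and> 0 < n \<and> parcs G \<subseteq> {0..<n} \<times> {0..<n} \<and> sym (parcs G) \<and> irrefl (parcs G) \<and>
    (\<forall>u\<in>{0..<n}. \<forall>v\<in>{0..<n}. (u, v) \<in> (parcs G)\<^sup>*)" (is "?L \<longleftrightarrow> ?R")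
proof
  assume L: ?L
  then have G: "pair_graph G" "pverts G = {0..<n}" "Digraph_Component.connected (with_proj G)"
    by (auto simp: connected_graphs_def)
  interpret pair_graph G by (rule G)
  have sub: "parcs G \<subseteq> {0..<n} \<times> {0..<n}"
    using G(2) in_arcsD1 in_arcsD2 by auto
  have sym: "sym (parcs G)"
    using sym_arcs by (simp add: symmetric_def)
  have "irrefl (parcs G)"
    using pair_no_loops unfolding irrefl_def by fastforce
  moreover have "(u, v) \<in> (parcs G)\<^sup>*" if "u < n" "v < n" for u v
  proof -
    have "(\<Union>e\<in>parcs G. {(fst e, snd e), (snd e, fst e)}) = parcs G"
      using sym by (auto dest: symD)
    then have "(u, v) \<in> rtrancl_on {0..<n} (parcs G)"
      using G(2,3) that
      by (auto simp: Digraph_Component.connected_def strongly_connected_def mk_symmetric_def reachable_def)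
    then show ?thesis by (rule rtrancl_on_rtranclI)
  qed
  moreover have "0 < n" using G(2,3) by (cases n) (auto simp: Digraph_Component.connected_def strongly_connected_def mk_symmetric_def)
  ultimately show ?R using sub sym G(2) by auto
next
  assume R: ?R
  have "finite (parcs G)" by (rule finite_subset[of _ "{0..<n} \<times> {0..<n}"]) (use R in auto)
  then interpret pair_graph G
    by unfold_locales (use R in \<open>auto simp: symmetric_def irrefl_def\<close>)
  have *: "(\<Union>e\<in>parcs G. {e, (snd e, fst e)}) = parcs G"
    using R by (auto dest: symD)
  have "(u, v) \<in> rtrancl_on {0..<n} (parcs G)" if "u < n" "v < n" for u v
  proof -
    have "(u, v) \<in> (parcs G)\<^sup>*" using R that by auto
    then show ?thesis
      using that(1) R by (induction rule: rtrancl_induct) (auto intro: rtrancl_on_into_rtrancl_on)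
  qed
  then have "Digraph_Component.connected (with_proj G)"
    using R by (auto simp: Digraph_Component.connected_def strongly_connected_def mk_symmetric_def * reachable_def)
  then show ?L using R pair_graph_axioms by (simp add: connected_graphs_def)
qed

text \<open>The equation of the signless Laplacian read vertex by vertex, for any vertex type.
  Positivity of \<open>x\<close> is what identifies \<open>q\<close> as the largest
  eigenvalue.\<close>

definition signless_eigenpair :: "'a set \<Rightarrow> 'a rel \<Rightarrow> real \<Rightarrow> ('a \<Rightarrow> real) \<Rightarrow> bool" where
  "signless_eigenpair V E q x \<longleftrightarrow>
    (\<forall>v\<in>V. 0 < x v) \<and> (\<forall>v\<in>V. q * x v = (\<Sum>u\<in>E `` {v}. x v + x u))"

lemma signless_laplacian_mult_vec:
  assumes G: "G \<in> connected_graphs n" and y: "y \<in> carrier_vec n" and i: "i < n"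
  shows "(signless_laplacian G *\<^sub>v y) $ i = (\<Sum>u\<in>parcs G `` {i}. y $ i + y $ u)"
proof -
  have R: "pverts G = {0..<n}" "parcs G \<subseteq> {0..<n} \<times> {0..<n}"
    using G by (auto simp: connected_graphs_iff)
  have N: "parcs G `` {i} = {u\<in>{0..<n}. (i, u) \<in> parcs G}" using R by auto
  have "out_arcs (with_proj G) i = Pair i ` (parcs G `` {i})" by (auto simp: out_arcs_def)
  then have deg: "out_degree (with_proj G) i = card (parcs G `` {i})"
    by (simp add: out_degree_def card_image inj_on_def)
  have "(signless_laplacian G *\<^sub>v y) $ i
      = (\<Sum>j\<in>{0..<n}. ((if i = j then real (card (parcs G `` {i})) else 0) +
          (if (i, j) \<in> parcs G then 1 else 0)) * y $ j)"
    using R y i deg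
    by (auto simp: signless_laplacian_def degree_matrix_def adjacency_matrix_def
        mult_mat_vec_def scalar_prod_def intro!: sum.cong)
  also have "\<dots> = real (card (parcs G `` {i})) * y $ i + (\<Sum>j\<in>{0..<n}. if (i, j) \<in> parcs G then y $ j else 0)"
    using i by (simp add: distrib_right sum.distrib if_distrib[of "\<lambda>c. c * _"] cong: if_cong)
  also have "(\<Sum>j\<in>{0..<n}. if (i, j) \<in> parcs G then y $ j else 0) = (\<Sum>u\<in>parcs G `` {i}. y $ u)"
    unfolding N by (rule sum.inter_filter[symmetric]) simp
  finally show ?thesis by (simp add: sum.distrib)
qed

text \<open>The variational eigenvector is positive, so by
  \<open>abs_eigenvalue_le_of_positive\<close> its eigenvalue dominates the spectrum. Hence a Perron
  vector exists, and the one chosen in \<open>principal_ratio\<close> satisfies the vertex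
  equations.\<close>

lemma principal_ratio_eigenpair:
  assumes G: "G \<in> connected_graphs n"
  obtains q :: real and x :: "nat \<Rightarrow> real" where "signless_eigenpair {0..<n} (parcs G) q x"
    "principal_ratio G = Max (x ` {0..<n}) / Min (x ` {0..<n})"
proof -
  let ?E = "parcs G" and ?V = "{0..<n}" and ?Q = "signless_laplacian G"
  have R: "pverts G = ?V" "0 < n" "?E \<subseteq> ?V \<times> ?V" "sym ?E" "\<And>u v. u \<in> ?V \<Longrightarrow> v \<in> ?V \<Longrightarrow> (u, v) \<in> ?E\<^sup>*"
    using G by (auto simp: connected_graphs_iff)
  have dim: "?Q \<in> carrier_mat n n"
    using R by (simp add: signless_laplacian_def degree_matrix_def adjacency_matrix_def)
  obtain q0 :: real and x0 :: "nat \<Rightarrow> real" where x0: "\<And>v. v \<in> ?V \<Longrightarrow> 0 < x0 v"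
      "\<And>v. v \<in> ?V \<Longrightarrow> q0 * x0 v = (\<Sum>u\<in>?E `` {v}. x0 v + x0 u)"
    using positive_signless_eigenvector[of ?V ?E] R by (metis atLeastLessThan_empty_iff finite_atLeastLessThan)
  have "eigenvector ?Q (vec n x0) q0"
    unfolding eigenvector_def
  proof (intro conjI)
    show "vec n x0 \<noteq> 0\<^sub>v (dim_row ?Q)"
    proof
      assume "vec n x0 = 0\<^sub>v (dim_row ?Q)"
      then have "vec n x0 $ 0 = 0\<^sub>v (dim_row ?Q) $ 0" by simp
      then show False using x0(1)[of 0] R(2) dim by simp
    qed
    show "?Q *\<^sub>v vec n x0 = q0 \<cdot>\<^sub>v vec n x0"
    proof (rule eq_vecI)
      fix i assume "i < dim_vec (q0 \<cdot>\<^sub>v vec n x0)"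
      then have i: "i < n" by simp
      have "(\<Sum>u\<in>?E `` {i}. vec n x0 $ i + vec n x0 $ u) = (\<Sum>u\<in>?E `` {i}. x0 i + x0 u)"
        using R i by (intro sum.cong) auto
      then show "(?Q *\<^sub>v vec n x0) $ i = (q0 \<cdot>\<^sub>v vec n x0) $ i"
        using signless_laplacian_mult_vec[OF G, of "vec n x0"] i x0(2)[of i] by simp
    qed (use dim in simp)
  qed (use dim in simp)
  moreover have "k \<le> q0" if k: "eigenvalue ?Q k" for k
  proof -
    obtain y where y: "y \<in> carrier_vec n" "y \<noteq> 0\<^sub>v n" "?Q *\<^sub>v y = k \<cdot>\<^sub>v y"
      using k dim by (auto simp: eigenvalue_def eigenvector_def)
    have "\<exists>i0<n. y $ i0 \<noteq> 0"
    proof (rule ccontr)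
      assume "\<not> (\<exists>i0<n. y $ i0 \<noteq> 0)"
      then have "y = 0\<^sub>v n" using y(1) by (intro eq_vecI) auto
      then show False using y(2) by simp
    qed
    then obtain i0 where i0: "i0 < n" "y $ i0 \<noteq> 0" by blast
    define A :: "nat \<Rightarrow> nat \<Rightarrow> real" where "A = (\<lambda>i j. ?Q $$ (i, j))"
    \<comment> \<open>Entries outside the index range are set to 0, because nonnegativity is
      demanded for all indices.\<close>
    define A' where "A' = (\<lambda>i j. if i < n \<and> j < n then A i j else 0)"
    have row: "(?Q *\<^sub>v z) $ i = (\<Sum>j\<in>?V. A' i j * z $ j)" if "z \<in> carrier_vec n" "i < n" for z :: "real vec" and i
      using that dim by (auto simp: A_def A'_def mult_mat_vec_def scalar_prod_def intro!: sum.cong)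
    have "\<bar>k\<bar> \<le> q0"
    proof (rule abs_eigenvalue_le_of_positive[of ?V A' x0 q0 k "\<lambda>i. y $ i" i0])
      show "0 \<le> A' i j" for i j
        using R by (auto simp: A'_def A_def signless_laplacian_def degree_matrix_def adjacency_matrix_def)
      show "q0 * x0 i = (\<Sum>j\<in>?V. A' i j * x0 j)" if "i \<in> ?V" for i
      proof -
        have "(\<Sum>j\<in>?V. A' i j * x0 j) = (\<Sum>j\<in>?V. A' i j * vec n x0 $ j)" by (intro sum.cong) auto
        also have "\<dots> = (?Q *\<^sub>v vec n x0) $ i" using that row[of "vec n x0" i] by simp
        also have "\<dots> = q0 * x0 i"
        proof -
          have "?Q *\<^sub>v vec n x0 = q0 \<cdot>\<^sub>v vec n x0"
            using \<open>eigenvector ?Q (vec n x0) q0\<close> by (simp only: eigenvector_def)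
          then show ?thesis using that by (simp only:) simp
        qed
        finally show ?thesis by simp
      qed
      show "k * y $ i = (\<Sum>j\<in>?V. A' i j * y $ j)" if "i \<in> ?V" for i
        using row[OF y(1), of i] y that by simp
    qed (use R x0 i0 in auto)
    then show ?thesis by simp
  qed
  ultimately have "largest_eigenvalue G = q0"
    unfolding largest_eigenvalue_def
    by (intro Max_eqI card_finite_spectrum[OF dim]) (auto simp: spectrum_def eigenvalue_def)
  with \<open>eigenvector ?Q (vec n x0) q0\<close> x0(1) have "perron_vector G (vec n x0)"
    by (auto simp: perron_vector_def vec_set_def)
  define y where "y = (SOME x. perron_vector G x)"
  have y: "perron_vector G y" unfolding y_def using \<open>perron_vector G (vec n x0)\<close> by (rule someI)
  then have ev: "eigenvector ?Q y (largest_eigenvalue G)" and pos: "\<forall>a\<in>set\<^sub>v y. 0 < a"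
    by (auto simp: perron_vector_def)
  then have yc: "y \<in> carrier_vec n" using dim by (simp add: eigenvector_def)
  then have set: "set\<^sub>v y = (\<lambda>i. y $ i) ` ?V" by (auto simp: vec_set_def)
  have "largest_eigenvalue G * y $ i = (\<Sum>u\<in>?E `` {i}. y $ i + y $ u)" if "i \<in> ?V" for i
    using signless_laplacian_mult_vec[OF G yc, of i] that ev yc by (simp add: eigenvector_def)
  then have "signless_eigenpair ?V ?E (largest_eigenvalue G) (\<lambda>i. y $ i)"
    using pos set by (auto simp: signless_eigenpair_def)
  moreover have "principal_ratio G = Max ((\<lambda>i. y $ i) ` ?V) / Min ((\<lambda>i. y $ i) ` ?V)"
    unfolding principal_ratio_def y_def[symmetric] Let_def set ..
  ultimately show ?thesis by (rule that)
qed

text \<open>Each vertex of \<open>T\<close> occurs in \<open>card T - 1\<close> ordered pairs as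
  first and in as many as second component.\<close>

lemma sum_pairs:
  fixes x :: "'a \<Rightarrow> real"
  assumes finT: "finite T"
  shows "(\<Sum>u\<in>T. \<Sum>v\<in>T - {u}. x u + x v) = 2 * (real (card T) - 1) * sum x T"
proof -
  define X where "X = sum x T"
    have "(\<Sum>v\<in>T - {u}. x u + x v) = (real (card T) - 2) * x u + X" if "u \<in> T" for u
    proof -
      have "0 < card T" using that finT by (auto simp: card_gt_0_iff)
      then have "real (card T - 1) = real (card T) - 1" by (simp add: of_nat_diff)
      then show ?thesis
        using that finT sum.remove[OF finT that, of x] by (simp add: sum.distrib X_def algebra_simps)
    qed
    then have "(\<Sum>u\<in>T. \<Sum>v\<in>T - {u}. x u + x v) = (\<Sum>u\<in>T. (real (card T) - 2) * x u + X)"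
      by (intro sum.cong) auto
    also have "\<dots> = (real (card T) - 2) * X + real (card T) * X"
      by (simp add: sum.distrib X_def sum_distrib_left)
    finally show ?thesis by (simp add: algebra_simps X_def)
qed

text \<open>Sum the eigenvalue equations over \<open>T\<close>: the arcs inside \<open>T\<close>
  alone contribute \<open>2 * (card T - 1) * sum x T\<close>, and an arc leaving \<open>T\<close>
  makes the inequality strict.\<close>

lemma eigenvalue_ge_clique:
  assumes ep: "signless_eigenpair V E q x" and fin: "finite V" "E \<subseteq> V \<times> V"
    and T: "T \<subseteq> V" "T \<noteq> {}" "\<And>u v. u \<in> T \<Longrightarrow> v \<in> T \<Longrightarrow> u \<noteq> v \<Longrightarrow> (u, v) \<in> E"
  shows "2 * (real (card T) - 1) \<le> q"
    and "u \<in> T \<Longrightarrow> w \<notin> T \<Longrightarrow> (u, w) \<in> E \<Longrightarrow> 2 * (real (card T) - 1) < q"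
proof -
  have pos: "\<And>v. v \<in> V \<Longrightarrow> 0 < x v" using ep by (auto simp: signless_eigenpair_def)
  have finT: "finite T" using T fin finite_subset by blast
  define X where "X = sum x T"
  have X: "0 < X" unfolding X_def using finT T pos by (intro sum_pos) auto
  have sub: "(\<Sum>v\<in>T - {u}. x u + x v) \<le> (\<Sum>v\<in>E `` {u}. x u + x v)" if "u \<in> T" for u
    using that T fin pos[THEN less_imp_le]
    by (intro sum_mono2) (auto intro: finite_subset intro!: add_nonneg_nonneg)
  have val: "(\<Sum>u\<in>T. \<Sum>v\<in>T - {u}. x u + x v) = 2 * (real (card T) - 1) * X"
    unfolding X_def by (rule sum_pairs[OF finT])
  have qX: "q * X = (\<Sum>u\<in>T. \<Sum>v\<in>E `` {u}. x u + x v)"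
    unfolding X_def sum_distrib_left using ep T by (intro sum.cong) (auto simp: signless_eigenpair_def)
  have "2 * (real (card T) - 1) * X \<le> q * X"
    unfolding val[symmetric] qX by (intro sum_mono sub)
  then show "2 * (real (card T) - 1) \<le> q" using X by simp
  assume uw: "u \<in> T" "w \<notin> T" "(u, w) \<in> E"
  have "(\<Sum>v\<in>T - {u}. x u + x v) < (\<Sum>v\<in>E `` {u}. x u + x v)"
  proof (rule sum_strict_mono2[of _ _ w])
    show "finite (E `` {u})" using fin by (auto intro: finite_subset)
    show "T - {u} \<subseteq> E `` {u}" "w \<in> E `` {u} - (T - {u})" using uw T(3) by auto
    have "u \<in> V" "w \<in> V" using uw fin by auto
    then show "0 < x u + x w" using pos[of u] pos[of w] by simp
    show "0 \<le> x u + x v" if "v \<in> E `` {u}" for v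
    proof -
      have "v \<in> V" using that fin by auto
      then show ?thesis using pos[of v] pos[OF \<open>u \<in> V\<close>] by simp
    qed
  qed
  then have "2 * (real (card T) - 1) * X < q * X"
    unfolding val[symmetric] qX using sub \<open>u \<in> T\<close> by (intro sum_strict_mono_ex1[OF finT]) blast+
  then show "2 * (real (card T) - 1) < q" using X by simp
qed

section \<open>Kites\<close>

lemma pverts_kite: "1 \<le> s \<Longrightarrow> pverts (kite (Suc k) s) = {0..<k + s}"
  by (auto simp: kite_def)

lemma parcs_kite:
  "(u, v) \<in> parcs (kite (Suc k) s) \<longleftrightarrow>
    u \<le> k \<and> v \<le> k \<and> (v = Suc u \<or> u = Suc v) \<or> k \<le> u \<and> u < k + s \<and> k \<le> v \<and> v < k + s \<and> u \<noteq> v"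
  by (auto simp: kite_def path_arcs_def complete_arcs_def)

lemma kite_in_connected_graphs:
  assumes "1 \<le> s"
  shows "kite (Suc k) s \<in> connected_graphs (k + s)"
proof -
  let ?E = "parcs (kite (Suc k) s)"
  have sym: "sym ?E" by (auto intro!: symI simp: parcs_kite)
  have from_0: "(0, u) \<in> ?E\<^sup>*" if "u \<le> k" for u
    using that
  proof (induction u)
    case (Suc u)
    then have "(u, Suc u) \<in> ?E" by (simp add: parcs_kite)
    with Suc show ?case by (meson Suc_leD rtrancl.rtrancl_into_rtrancl)
  qed simp
  have "(0, u) \<in> ?E\<^sup>*" if "u < k + s" for u
  proof (cases "u \<le> k")
    case False
    then have "(k, u) \<in> ?E" using that by (simp add: parcs_kite)
    then show ?thesis using from_0[of k] by simp
  qed (rule from_0)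
  moreover have "sym (?E\<^sup>*)" using sym by (rule sym_rtrancl)
  ultimately have "(u, v) \<in> ?E\<^sup>*" if "u < k + s" "v < k + s" for u v
    using that by (meson rtrancl_trans symD)
  moreover have "?E \<subseteq> {0..<k + s} \<times> {0..<k + s}" using assms by (auto simp: parcs_kite)
  moreover have "irrefl ?E" by (auto simp: irrefl_def parcs_kite)
  ultimately show ?thesis using sym pverts_kite[OF assms] assms by (simp add: connected_graphs_iff)
qed

text \<open>Solving the equation at a vertex of degree 2 for the next entry, and dividing by the
  current one, reproduces the recursion of \<open>growth\<close>; the end vertex of degree 1 gives
  its initial value.\<close>

lemma pendant_path_growth:
  assumes eq0: "q * x 0 = x 0 + x (Suc 0)"
    and eq: "\<And>i. 0 < i \<Longrightarrow> i < k \<Longrightarrow> q * x i = 2 * x i + x (i - 1) + x (Suc i)"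
    and pos: "\<And>i. i \<le> k \<Longrightarrow> 0 < x i"
    and i: "i < k"
  shows "x (Suc i) = growth q i * x i"
  using i
proof (induction i)
  case 0
  then show ?case using eq0 by (simp add: algebra_simps)
next
  case (Suc i)
  have "growth q i * x i = x (Suc i)" using Suc by simp
  moreover have "growth q i \<noteq> 0" using calculation pos[of "Suc i"] Suc.prems by auto
  ultimately have "x i = 1 / growth q i * x (Suc i)" by (simp add: field_simps)
  then show ?case using eq[of "Suc i"] Suc.prems by (simp add: algebra_simps)
qed

lemma path_growth_eq:
  assumes "\<And>i. i < k \<Longrightarrow> x (Suc i) = growth q i * x i"
  shows "x k = path_growth q k * x 0"
  using assms by (induction k) auto

text \<open>The eigenvalue bounds come from the clique \<open>{k..<k + s}\<close>, which the path
  leaves at vertex \<open>k\<close>. The ratio is bounded by the quotient of the entries at the two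
  ends of the path.\<close>

lemma kite_eigenpair:
  assumes s: "1 \<le> s"
  obtains q x where "signless_eigenpair {0..<k + s} (parcs (kite (Suc k) s)) q x"
    "2 * (real s - 1) \<le> q" "0 < k \<Longrightarrow> 2 * (real s - 1) < q"
    "path_growth q k \<le> principal_ratio (kite (Suc k) s)"
proof -
  let ?E = "parcs (kite (Suc k) s)" and ?V = "{0..<k + s}"
  obtain q x where ep: "signless_eigenpair ?V ?E q x"
    and pr: "principal_ratio (kite (Suc k) s) = Max (x ` ?V) / Min (x ` ?V)"
    using principal_ratio_eigenpair[OF kite_in_connected_graphs[OF s]] by metis
  have pos: "\<And>v. v \<in> ?V \<Longrightarrow> 0 < x v" and eq: "\<And>v. v \<in> ?V \<Longrightarrow> q * x v = (\<Sum>u\<in>?E `` {v}. x v + x u)"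
    using ep by (auto simp: signless_eigenpair_def)
  have sub: "?E \<subseteq> ?V \<times> ?V" using s by (auto simp: parcs_kite)
  have "2 * (real (card {k..<k + s}) - 1) \<le> q"
    by (rule eigenvalue_ge_clique(1)[OF ep _ sub]) (use s in \<open>auto simp: parcs_kite\<close>)
  moreover have "2 * (real (card {k..<k + s}) - 1) < q" if "0 < k"
    by (rule eigenvalue_ge_clique(2)[OF ep _ sub, of _ k "k - 1"]) (use s that in \<open>auto simp: parcs_kite\<close>)
  moreover have "path_growth q k \<le> Max (x ` ?V) / Min (x ` ?V)"
  proof -
    have "x (Suc i) = growth q i * x i" if "i < k" for i
    proof (rule pendant_path_growth[OF _ _ _ that])
      have "?E `` {0} = {Suc 0}" using that s by (auto simp: parcs_kite)
      then show "q * x 0 = x 0 + x (Suc 0)" using eq[of 0] s by simp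
      show "q * x i = 2 * x i + x (i - 1) + x (Suc i)" if "0 < i" "i < k" for i
      proof -
        have "?E `` {i} = {i - 1, Suc i}" using that s by (auto simp: parcs_kite)
        then show ?thesis using eq[of i] that s by simp
      qed
      show "0 < x i" if "i \<le> k" for i using pos[of i] that s by auto
    qed
    then have "x k = path_growth q k * x 0" by (rule path_growth_eq)
    moreover have "x k \<le> Max (x ` ?V)" "Min (x ` ?V) \<le> x 0" using s by auto
    moreover have "0 < Min (x ` ?V)" "0 < x 0" "0 < x k" using pos s by (auto simp: Min_gr_iff)
    ultimately have "x k / x 0 \<le> Max (x ` ?V) / Min (x ` ?V)" by (intro frac_le) auto
    then show ?thesis using \<open>x k = _\<close> \<open>0 < x 0\<close> by simp
  qed
  ultimately show ?thesis using that[OF ep] pr by simp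
qed

section \<open>Comparing eigenvalues of subgraphs and transporting eigenpairs\<close>

lemma signless_form_eigenpair:
  assumes ep: "signless_eigenpair V E q x" and V: "finite V" "E \<subseteq> V \<times> V" "sym E"
  shows "(\<Sum>(a,b)\<in>E. (x a + x b) * (y a + y b)) = 2 * q * (\<Sum>v\<in>V. x v * y v)"
proof -
  have E: "E = Sigma V (\<lambda>v. E `` {v})" using V by auto
  have fin: "finite (E `` {v})" for v using V by (auto intro: finite_subset)
  have "(\<Sum>(a,b)\<in>E. (x a + x b) * y a) = (\<Sum>a\<in>V. \<Sum>b\<in>E `` {a}. (x a + x b) * y a)"
    using sum.Sigma[of V "\<lambda>v. E `` {v}" "\<lambda>a b. (x a + x b) * y a"] V fin E by auto
  also have "\<dots> = (\<Sum>a\<in>V. q * (x a * y a))"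
    using ep by (intro sum.cong) (auto simp: signless_eigenpair_def sum_distrib_right[symmetric])
  finally have 1: "(\<Sum>(a,b)\<in>E. (x a + x b) * y a) = q * (\<Sum>v\<in>V. x v * y v)"
    by (simp add: sum_distrib_left)
  have "(\<Sum>(a,b)\<in>E. (x a + x b) * y b) = (\<Sum>(a,b)\<in>E. (x a + x b) * y a)"
    by (rule sum.reindex_bij_witness[of _ prod.swap prod.swap]) (use V in \<open>auto dest: symD\<close>)
  moreover have "(\<Sum>(a,b)\<in>E. (x a + x b) * (y a + y b)) =
      (\<Sum>(a,b)\<in>E. (x a + x b) * y a) + (\<Sum>(a,b)\<in>E. (x a + x b) * y b)"
    unfolding sum.distrib[symmetric] by (intro sum.cong) (auto simp: algebra_simps)
  ultimately show ?thesis using 1 by simp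
qed

text \<open>Evaluate the bilinear form at both eigenvectors: over \<open>E\<close> it is
  \<open>2 * q\<close> and over \<open>F\<close> it is \<open>2 * q'\<close> times their inner
  product. A missing arc has positive weight, so a proper inclusion forces
  \<open>q < q'\<close>.\<close>

lemma eigenvalue_subgraph_eq:
  assumes E: "signless_eigenpair V E q x" and F: "signless_eigenpair V F q' y"
    and V: "finite V" "V \<noteq> {}" "E \<subseteq> F" "F \<subseteq> V \<times> V" "sym E" "sym F" and le: "q' \<le> q"
  shows "E = F"
proof (rule ccontr)
  assume "E \<noteq> F"
  then obtain e where e: "e \<in> F - E" using V by auto
  let ?g = "\<lambda>(a, b). (x a + x b) * (y a + y b)"
  have px: "\<And>v. v \<in> V \<Longrightarrow> 0 < x v" and py: "\<And>v. v \<in> V \<Longrightarrow> 0 < y v"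
    using E F by (auto simp: signless_eigenpair_def)
  have finF: "finite F" using V finite_subset by blast
  have gpos: "0 < ?g e" if "e \<in> F" for e
  proof -
    obtain a b where "e = (a, b)" "a \<in> V" "b \<in> V" using \<open>e \<in> F\<close> V by auto
    then show ?thesis using px[of a] px[of b] py[of a] py[of b] by (simp add: mult_pos_pos)
  qed
  have "sum ?g E < sum ?g F"
    by (rule sum_strict_mono2[OF finF V(3) e]) (use gpos e V in \<open>auto intro: less_imp_le\<close>)
  moreover have "sum ?g E = 2 * q * (\<Sum>v\<in>V. x v * y v)"
    using signless_form_eigenpair[OF E, of y] V by auto
  moreover have "sum ?g F = 2 * q' * (\<Sum>v\<in>V. x v * y v)"
  proof -
    have "sum ?g F = (\<Sum>(a,b)\<in>F. (y a + y b) * (x a + x b))" by (intro sum.cong) auto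
    then show ?thesis
      using signless_form_eigenpair[OF F, of x] V by (simp add: mult.commute[of "x _"])
  qed
  moreover have "0 < (\<Sum>v\<in>V. x v * y v)" using V px py by (intro sum_pos) auto
  ultimately have "q < q'" by simp
  with le show False by simp
qed

text \<open>Lets a kite be compared with a graph on the vertex labels of that graph.\<close>

lemma signless_eigenpair_pullback:
  assumes bij: "bij_betw h V W" and ep: "signless_eigenpair W F q y" and F: "F \<subseteq> W \<times> W"
  shows "signless_eigenpair V {(u, v). u \<in> V \<and> v \<in> V \<and> (h u, h v) \<in> F} q (y \<circ> h)"
proof -
  let ?E = "{(u, v). u \<in> V \<and> v \<in> V \<and> (h u, h v) \<in> F}"
  have hV: "h v \<in> W" if "v \<in> V" for v using bij that by (auto simp: bij_betw_def)
  have "q * y (h v) = (\<Sum>u\<in>?E `` {v}. y (h v) + y (h u))" if v: "v \<in> V" for v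
  proof -
    have "bij_betw h (?E `` {v}) (F `` {h v})"
    proof (rule bij_betw_imageI)
      show "inj_on h (?E `` {v})"
        using bij by (auto simp: bij_betw_def intro: inj_on_subset)
      show "h ` (?E `` {v}) = F `` {h v}"
        using bij F v by (auto simp: bij_betw_def)
    qed
    then have "(\<Sum>u\<in>?E `` {v}. y (h v) + y (h u)) = (\<Sum>u\<in>F `` {h v}. y (h v) + y u)"
      by (rule sum.reindex_bij_betw)
    then show ?thesis using ep hV[OF v] by (simp add: signless_eigenpair_def)
  qed
  then show ?thesis using ep hV by (auto simp: signless_eigenpair_def)
qed

lemma digraph_isoI:
  fixes G :: "'a pair_pre_digraph" and H :: "'b pair_pre_digraph"
  assumes wf: "pair_wf_digraph G" and bij: "bij_betw h (pverts G) (pverts H)"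
    and arcs: "parcs H = map_prod h h ` parcs G"
  shows "digraph_iso (with_proj G) (with_proj H)"
proof -
  interpret pair_wf_digraph G by (rule wf)
  let ?f = "\<lparr>iso_verts = h, iso_arcs = map_prod h h, iso_head = snd, iso_tail = fst\<rparr>"
  have inj: "inj_on h (pverts G)" using bij by (rule bij_betw_imp_inj_on)
  have "inj_on (map_prod h h) (parcs G)"
  proof (rule inj_on_subset[OF map_prod_inj_on[OF inj inj]])
    show "parcs G \<subseteq> pverts G \<times> pverts G" using in_arcsD1 in_arcsD2 by auto
  qed
  then have "pre_digraph.digraph_isomorphism (with_proj G) ?f"
    using inj wf_digraph_axioms by (simp add: pre_digraph.digraph_isomorphism_def)
  moreover have "with_proj H = app_iso ?f (with_proj G)"
    using bij arcs by (simp add: app_iso_def with_proj_def bij_betw_def)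
  ultimately show ?thesis unfolding digraph_iso_def by blast
qed

section \<open>Shortest paths from a minimal to a maximal entry\<close>

lemma relpow_split: "(a, b) \<in> R ^^ i \<Longrightarrow> (b, c) \<in> R ^^ j \<Longrightarrow> (a, c) \<in> R ^^ (i + j)"
  by (auto simp: relpow_add)

lemma relpow_path: "(\<And>i. i < k \<Longrightarrow> (p i, p (Suc i)) \<in> R) \<Longrightarrow> i \<le> j \<Longrightarrow> j \<le> k \<Longrightarrow> (p i, p j) \<in> R ^^ (j - i)"
proof (induction j)
  case (Suc j)
  show ?case
  proof (cases "i = Suc j")
    case False
    then have "(p i, p j) \<in> R ^^ (j - i)" "(p j, p (Suc j)) \<in> R" "Suc j - i = Suc (j - i)"
      using Suc by auto
    then show ?thesis by auto
  qed simp
qed simp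

text \<open>In a walk of least length, a walk from \<open>p i\<close> to \<open>p j\<close> in fewer
  than \<open>j - i\<close> steps would be a shortcut.\<close>

lemma shortest_path_exists:
  assumes "(u, w) \<in> E\<^sup>*"
  obtains k p where "p 0 = u" "p k = w" "\<And>i. i < k \<Longrightarrow> (p i, p (Suc i)) \<in> E"
    "\<And>i j m. i \<le> k \<Longrightarrow> j \<le> k \<Longrightarrow> (p i, p j) \<in> E ^^ m \<Longrightarrow> j \<le> i + m"
proof -
  define k where "k = (LEAST k. (u, w) \<in> E ^^ k)"
  have ex: "\<exists>k. (u, w) \<in> E ^^ k" using assms by (rule rtrancl_imp_relpow)
  then have "(u, w) \<in> E ^^ k" unfolding k_def by (rule LeastI_ex)
  then obtain p where p: "p 0 = u" "p k = w" "\<And>i. i < k \<Longrightarrow> (p i, p (Suc i)) \<in> E"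
    by (auto simp: relpow_fun_conv)
  have "j \<le> i + m" if "i \<le> k" "j \<le> k" "(p i, p j) \<in> E ^^ m" for i j m
  proof -
    have "(p 0, p i) \<in> E ^^ i" "(p j, p k) \<in> E ^^ (k - j)"
      using relpow_path[of k p E 0 i] relpow_path[of k p E j k] p(3) that by auto
    then have "(u, w) \<in> E ^^ (i + m + (k - j))"
      using relpow_split[OF relpow_split[OF _ that(3)]] p(1,2) by metis
    then have "k \<le> i + m + (k - j)" unfolding k_def by (rule Least_le)
    then show ?thesis using that by simp
  qed
  with p show ?thesis by (rule that)
qed

text \<open>\<open>x\<close> is scaled to have maximum 1, attained at \<open>p L\<close>; when
  \<open>p 0\<close> carries the minimal entry, \<open>1 / x (p 0)\<close> is the principal
  ratio.\<close>

locale geodesic_eigenpair =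
  fixes V :: "'a set" and E :: "'a rel" and q :: real and x :: "'a \<Rightarrow> real"
    and p :: "nat \<Rightarrow> 'a" and L M :: nat
  assumes finV: "finite V" and EV: "E \<subseteq> V \<times> V" and symE: "sym E" and irreflE: "irrefl E"
    and ep: "signless_eigenpair V E q x"
    and cardV: "card V = L + 1 + M"
    and pV: "\<And>i. i \<le> L \<Longrightarrow> p i \<in> V"
    and p_edge: "\<And>i. i < L \<Longrightarrow> (p i, p (Suc i)) \<in> E"
    and geodesic: "\<And>i j m. i \<le> L \<Longrightarrow> j \<le> L \<Longrightarrow> (p i, p j) \<in> E ^^ m \<Longrightarrow> j \<le> i + m"
    and x_le: "\<And>v. v \<in> V \<Longrightarrow> x v \<le> 1" and x_top: "x (p L) = 1"
begin

definition S :: "'a set" where "S = V - p ` {..L}"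

lemma finN: "finite (E `` {v})"
  using finV EV by (auto intro: finite_subset)

lemma NV: "E `` {v} \<subseteq> V"
  using EV by auto

lemma x_pos: "v \<in> V \<Longrightarrow> 0 < x v"
  using ep by (simp add: signless_eigenpair_def)

lemma xp_pos: "i \<le> L \<Longrightarrow> 0 < x (p i)"
  using x_pos pV by blast

lemma eigen_eq: "v \<in> V \<Longrightarrow> q * x v = card (E `` {v}) * x v + sum x (E `` {v})"
  using ep by (simp add: signless_eigenpair_def sum.distrib)

lemma edgeD: "(u, v) \<in> E \<Longrightarrow> u \<in> V" "(u, v) \<in> E \<Longrightarrow> v \<in> V"
  using EV by auto

lemma sum_nbrs_ge: "A \<subseteq> E `` {v} \<Longrightarrow> sum x A \<le> sum x (E `` {v})"
  by (intro sum_mono2 finN) (auto intro: less_imp_le x_pos edgeD)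

lemma inj_p: "inj_on p {..L}"
proof (rule inj_onI)
  fix i j assume "i \<in> {..L}" "j \<in> {..L}" "p i = p j"
  then show "i = j" using geodesic[of i j 0] geodesic[of j i 0] by auto
qed

lemma p_eq_iff: "i \<le> L \<Longrightarrow> j \<le> L \<Longrightarrow> p i = p j \<longleftrightarrow> i = j"
  using inj_p by (auto simp: inj_on_def)

lemma p_edge_iff:
  assumes "i \<le> L" "j \<le> L"
  shows "(p i, p j) \<in> E \<longleftrightarrow> j = Suc i \<or> i = Suc j"
proof
  assume e: "(p i, p j) \<in> E"
  then have "(p j, p i) \<in> E" "i \<noteq> j" using symE irreflE by (auto dest: symD simp: irrefl_def)
  then show "j = Suc i \<or> i = Suc j"
    using e geodesic[of i j 1] geodesic[of j i 1] assms by auto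
next
  assume "j = Suc i \<or> i = Suc j"
  then show "(p i, p j) \<in> E" using p_edge[of i] p_edge[of j] assms symE by (auto dest: symD)
qed

lemma geodesic_2:
  assumes "i \<le> L" "j \<le> L" "(p i, u) \<in> E" "(u, p j) \<in> E"
  shows "j \<le> i + 2"
proof -
  have "(p i, p j) \<in> E ^^ 2" using assms by (auto simp: numeral_2_eq_2)
  then show ?thesis using geodesic assms by blast
qed

lemma finS: "finite S" and SV: "S \<subseteq> V"
  using finV by (auto simp: S_def)

lemma cardS: "card S = M"
proof -
  have "card (p ` {..L}) = L + 1" using card_image[OF inj_p] by simp
  moreover have "p ` {..L} \<subseteq> V" using pV by auto
  ultimately show ?thesis using cardV by (simp add: S_def card_Diff_subset)
qed

lemma V_eq: "V = p ` {..L} \<union> S"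
  using pV by (auto simp: S_def)

lemma p_notin_S: "i \<le> L \<Longrightarrow> p i \<notin> S"
  by (auto simp: S_def)

lemma nbrs_path:
  assumes "i \<le> L"
  shows "E `` {p i} = {u \<in> S. (p i, u) \<in> E} \<union> p ` {j. j \<le> L \<and> (j = Suc i \<or> i = Suc j)}"
proof (rule Set.set_eqI)
  fix u
  show "u \<in> E `` {p i} \<longleftrightarrow> u \<in> {u \<in> S. (p i, u) \<in> E} \<union> p ` {j. j \<le> L \<and> (j = Suc i \<or> i = Suc j)}"
  proof (cases "u \<in> S")
    case True
    then have "u \<notin> p ` {j. j \<le> L \<and> (j = Suc i \<or> i = Suc j)}" using p_notin_S by blast
    then show ?thesis using True by blast
  next
    case False
    show ?thesis
    proof (cases "u \<in> V")
      case True
      then obtain j where "u = p j" "j \<le> L" using False by (auto simp: S_def)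
      then show ?thesis using False p_edge_iff[OF assms, of j] p_eq_iff[of j] by (auto simp: image_iff)
    next
      case False
      then show ?thesis using edgeD(2) SV pV by blast
    qed
  qed
qed

lemma nbrs_top: "E `` {p L} \<subseteq> insert (p (L - 1)) S"
  using nbrs_path[of L] by auto

text \<open>At \<open>p L\<close> the entry is 1 and the neighbours have entries at most 1, so
  \<open>q\<close> is at most twice the degree. As the path is geodesic, neighbours lie in
  \<open>S\<close> or are \<open>p (L - 1)\<close>.\<close>

lemma q_le: "q \<le> 2 * (M + 1)"
proof -
  have "q * x (p L) = card (E `` {p L}) * x (p L) + sum x (E `` {p L})"
    by (rule eigen_eq) (simp add: pV)
  moreover have "sum x (E `` {p L}) \<le> card (E `` {p L})"
    using sum_mono[of "E `` {p L}" x "\<lambda>_. 1"] x_le NV by auto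
  moreover have "card (E `` {p L}) \<le> M + 1"
    using card_mono[OF _ nbrs_top] card_insert_le_m1[of "M + 1" S "p (L - 1)"] finS cardS by simp
  ultimately show ?thesis using x_top by simp
qed

lemma step_le: "i < L \<Longrightarrow> x (p (Suc i)) \<le> (q - 1) * x (p i)"
proof -
  assume i: "i < L"
  have "{p (Suc i)} \<subseteq> E `` {p i}" using p_edge[OF i] by auto
  then have "1 \<le> card (E `` {p i})" "x (p (Suc i)) \<le> sum x (E `` {p i})"
    using card_mono[OF finN, of "{p (Suc i)}" "p i"] sum_nbrs_ge[of "{p (Suc i)}" "p i"] by auto
  moreover have "1 * x (p i) \<le> card (E `` {p i}) * x (p i)"
    using \<open>1 \<le> card _\<close> xp_pos[of i] i by (intro mult_right_mono) auto
  ultimately show ?thesis using eigen_eq[OF pV, of i] i by (simp add: algebra_simps)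
qed

lemma q_gt_1: "0 < L \<Longrightarrow> 1 < q"
proof -
  assume "0 < L"
  then have "0 < (q - 1) * x (p 0)" "0 < x (p 0)" using step_le[of 0] xp_pos[of 0] xp_pos[of 1] by auto
  then show ?thesis by (simp add: zero_less_mult_iff)
qed

text \<open>A crude bound without a lower bound on \<open>q\<close>; it serves to establish
  \<open>4 \<le> q\<close> and that \<open>M\<close> is large.\<close>

lemma ratio_le_power: "1 / x (p 0) \<le> (q - 1) ^ L"
proof -
  have "i \<le> L \<Longrightarrow> x (p i) \<le> (q - 1) ^ i * x (p 0)" for i
  proof (induction i)
    case (Suc i)
    have "x (p (Suc i)) \<le> (q - 1) * x (p i)" using step_le Suc by simp
    also have "\<dots> \<le> (q - 1) * ((q - 1) ^ i * x (p 0))"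
      using Suc q_gt_1 by (intro mult_left_mono) auto
    finally show ?case by (simp add: mult.assoc)
  qed simp
  from this[of L] show ?thesis using x_top xp_pos[of 0] by (simp add: field_simps)
qed

text \<open>Extra neighbours of a path vertex only slow down the growth: degree at least 2 and the
  two path neighbours give the recursion of \<open>growth\<close> as an inequality.\<close>

lemma step_le_growth:
  assumes q: "4 \<le> q"
  shows "i < L \<Longrightarrow> x (p (Suc i)) \<le> growth q i * x (p i)"
proof (induction i)
  case 0
  then show ?case using step_le[of 0] by simp
next
  case (Suc i)
  have sub: "{p i, p (Suc (Suc i))} \<subseteq> E `` {p (Suc i)}"
    using Suc.prems by (auto simp: p_edge_iff)
  have ne: "p i \<noteq> p (Suc (Suc i))" using Suc.prems by (simp add: p_eq_iff)
  have "2 \<le> card (E `` {p (Suc i)})" "x (p i) + x (p (Suc (Suc i))) \<le> sum x (E `` {p (Suc i)})"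
    using card_mono[OF finN sub] sum_nbrs_ge[OF sub] ne by simp_all
  moreover have "2 * x (p (Suc i)) \<le> card (E `` {p (Suc i)}) * x (p (Suc i))"
    using \<open>2 \<le> card _\<close> xp_pos[of "Suc i"] Suc.prems by (intro mult_right_mono) auto
  ultimately have "x (p (Suc (Suc i))) \<le> (q - 2) * x (p (Suc i)) - x (p i)"
    using eigen_eq[OF pV, of "Suc i"] Suc.prems by (simp add: algebra_simps)
  moreover have "1 / growth q i * x (p (Suc i)) \<le> x (p i)"
    using Suc growth_pos[OF q, of i] by (simp add: field_simps)
  ultimately show ?case by (simp add: algebra_simps)
qed

lemma ratio_le_path_growth:
  assumes q: "4 \<le> q"
  shows "1 / x (p 0) \<le> path_growth q L"
proof -
  have "i \<le> L \<Longrightarrow> x (p i) \<le> path_growth q i * x (p 0)" for i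
  proof (induction i)
    case (Suc i)
    have "x (p (Suc i)) \<le> growth q i * x (p i)" using step_le_growth[OF q] Suc by simp
    also have "\<dots> \<le> growth q i * (path_growth q i * x (p 0))"
      using Suc growth_pos[OF q] by (intro mult_left_mono) (auto simp: less_imp_le)
    finally show ?case by (simp add: mult_ac)
  qed simp
  from this[of L] show ?thesis using x_top xp_pos[of 0] by (simp add: field_simps)
qed

end

section \<open>Eigenvectors of extremal graphs\<close>

text \<open>The conditions are tailored to the three asymptotic estimates below: \<open>L_gt\<close> and the cases of
  small and of large \<open>\<beta>\<close> in \<open>B_empty\<close>.\<close>

definition large :: "real \<Rightarrow> bool" where
  "large m \<longleftrightarrow> exp 4000 < 2 * m - 5 \<and> 60 * ln (3 * m) / sqrt m \<le> 3 / 10 \<and>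
     exp (30 * ln (3 * m) / m * (m / 400 + 1)) < sqrt m / 2"

lemma eventually_large: "eventually large at_top"
  unfolding large_def by (intro eventually_conj) real_asymp+

lemma large_ge: "large m \<Longrightarrow> 2000 \<le> m"
  using exp_ge_add_one_self[of 4000] by (simp add: large_def)

text \<open>\<open>kites\<close> expresses extremality: no kite on the same number of vertices has a
  ratio above \<open>1 / x (p 0)\<close>. Here \<open>q'\<close> stands for the eigenvalue of the
  kite, known only from below.\<close>

locale extremal_eigenpair = geodesic_eigenpair +
  assumes kites: "\<And>k s. 1 \<le> s \<Longrightarrow> k + s = L + 1 + M \<Longrightarrow>
      \<exists>q'. 2 * (real s - 1) \<le> q' \<and> (0 < k \<longrightarrow> 2 * (real s - 1) < q') \<and> path_growth q' k \<le> 1 / x (p 0)"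
    and large_M: "large M"
begin

lemma M_ge: "2000 \<le> M"
  using large_ge[OF large_M] by simp

lemma ratio_ge_kite:
  assumes "1 \<le> s" "k + s = L + 1 + M" "4 \<le> t" "t \<le> 2 * (real s - 1)"
  shows "path_growth t k \<le> 1 / x (p 0)"
proof -
  obtain q' where "2 * (real s - 1) \<le> q'" "path_growth q' k \<le> 1 / x (p 0)"
    using kites[OF assms(1,2)] by blast
  then show ?thesis using path_growth_mono[of t q' k] assms by linarith
qed

text \<open>For \<open>L = 0\<close> the ratio would be 1, but a clique with one pendant vertex has
  a larger one.\<close>

lemma L_pos: "0 < L"
proof (rule ccontr)
  assume "\<not> 0 < L"
  then have "path_growth (2 * (real M - 1)) 1 \<le> 1 / x (p 0)"
    using M_ge by (intro ratio_ge_kite[of M]) auto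
  then show False using M_ge x_top \<open>\<not> 0 < L\<close> by (simp add: path_growth_def)
qed

text \<open>For \<open>q < 4\<close> the ratio would be at most \<open>3 ^ L\<close>, far below that
  of the kite with clique size \<open>M + 1\<close>.\<close>

lemma q_ge_4: "4 \<le> q"
proof (rule ccontr)
  assume "\<not> 4 \<le> q"
  have "(2 * real M - 3) ^ L \<le> path_growth (2 * real M) L"
    using path_growth_ge[of "2 * real M" L] M_ge by simp
  also have "\<dots> \<le> 1 / x (p 0)" using M_ge by (intro ratio_ge_kite[of "M + 1"]) auto
  also have "\<dots> \<le> (q - 1) ^ L" by (rule ratio_le_power)
  also have "\<dots> \<le> 3 ^ L" using q_gt_1[OF L_pos] \<open>\<not> 4 \<le> q\<close> by (intro power_mono) auto
  also have "\<dots> < (2 * real M - 3) ^ L" using M_ge L_pos by (intro power_strict_mono) auto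
  finally show False by simp
qed

text \<open>The ratio is at most \<open>path_growth q L\<close>, which is strictly increasing in
  \<open>q\<close>.\<close>

lemma kite_le_q:
  assumes "4 \<le> q'" "path_growth q' L \<le> 1 / x (p 0)"
  shows "q' \<le> q"
  using path_growth_strict_mono[of q q' L] ratio_le_path_growth[OF q_ge_4] q_ge_4 L_pos assms
  by linarith

lemma q_gt: "2 * real M < q"
proof -
  obtain q' where "2 * (real (M + 1) - 1) < q'" "path_growth q' L \<le> 1 / x (p 0)"
    using kites[of "M + 1" L] L_pos by auto
  then show ?thesis using kite_le_q[of q'] M_ge by simp
qed

text \<open>\<open>2 * M < q\<close>, and \<open>q\<close> is at most twice the degree of
  \<open>p L\<close>; so this degree exceeds \<open>M\<close> and \<open>nbrs_top\<close> is an
  equality.\<close>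

lemma nbrs_top_eq: "E `` {p L} = insert (p (L - 1)) S"
proof (rule card_subset_eq[OF _ nbrs_top])
  have "q * x (p L) = card (E `` {p L}) * x (p L) + sum x (E `` {p L})"
    by (rule eigen_eq) (simp add: pV)
  moreover have "sum x (E `` {p L}) \<le> card (E `` {p L})"
    using sum_mono[of "E `` {p L}" x "\<lambda>_. 1"] x_le edgeD by auto
  ultimately have "M < card (E `` {p L})" using q_gt x_top by simp
  moreover have "card (insert (p (L - 1)) S) = M + 1"
    using finS cardS p_notin_S[of "L - 1"] by simp
  moreover have "card (E `` {p L}) \<le> card (insert (p (L - 1)) S)"
    using nbrs_top finS by (intro card_mono) auto
  ultimately show "card (E `` {p L}) = card (insert (p (L - 1)) S)" by simp
qed (use finS in simp)

lemma top_S: "u \<in> S \<Longrightarrow> (u, p L) \<in> E"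
  using nbrs_top_eq symE by (auto dest: symD)

text \<open>All of \<open>S\<close> is adjacent to \<open>p L\<close>, so such an edge would give a
  walk of length 2 from \<open>p i\<close> to \<open>p L\<close>.\<close>

lemma not_adj_S: "i + 2 < L \<Longrightarrow> u \<in> S \<Longrightarrow> (p i, u) \<notin> E"
  using geodesic_2[of i L u] top_S[of u] by auto

text \<open>Comparison with \<open>P\<^bsub>L+2\<^esub> \<cdot> K\<^bsub>M\<^esub>\<close>.\<close>

lemma L_gt: "1000 * (2 * real M - 5) < L"
proof -
  let ?t = "2 * real M - 2"
  have t: "5 \<le> ?t" "?t \<le> 2 * real M + 2" using M_ge by auto
  have q: "q \<le> 2 * real M + 2" using q_le by simp
  have "path_growth ?t L * growth ?t L = path_growth ?t (Suc L)" by simp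
  also have "\<dots> \<le> 1 / x (p 0)" using M_ge by (intro ratio_ge_kite[of M]) auto
  also have "\<dots> \<le> path_growth q L" by (rule ratio_le_path_growth[OF q_ge_4])
  also have "\<dots> \<le> path_growth (2 * real M + 2) L" by (rule path_growth_mono[OF q_ge_4 q])
  also have "\<dots> \<le> path_growth ?t L * ((2 * real M + 2 - 3) / (?t - 3)) ^ L"
    by (rule path_growth_le_scale[OF t])
  \<comment> \<open>The longer kite gains a factor of about \<open>2 * M\<close> by its extra path
    edge. The eigenvalues differ by at most 4, which must compensate over \<open>L\<close> steps;
    this forces \<open>L\<close> to be large.\<close>
  finally have "growth ?t L \<le> ((2 * real M + 2 - 3) / (?t - 3)) ^ L"
    using path_growth_pos[of ?t L] t by simp
  moreover have "2 * real M - 5 \<le> growth ?t L" using growth_ge[of ?t L] t by simp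
  moreover have "((2 * real M + 2 - 3) / (?t - 3)) ^ L \<le> exp (L * 4 / (2 * real M - 5))"
    using power_ratio_le_exp[of "2 * real M - 5" 4 L] M_ge by (simp add: algebra_simps)
  moreover have "exp 4000 < 2 * real M - 5" using large_M by (simp add: large_def)
  ultimately have "exp 4000 < exp (L * 4 / (2 * real M - 5))" by linarith
  then show ?thesis using M_ge by (simp add: field_simps)
qed


section \<open>The entries at the last path vertices and their neighbours in
  \<open>S\<close>\<close>

definition a :: real where "a = x (p (L - 2))"
definition b :: real where "b = x (p (L - 1))"
definition A :: "'a set" where "A = {u \<in> S. (p (L - 2), u) \<in> E}"
definition B :: "'a set" where "B = {u \<in> S. (p (L - 1), u) \<in> E}"

lemma L_ge: "3 \<le> L"
  using L_gt M_ge by simp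

lemma finA: "finite A" and finB: "finite B" and AS: "A \<subseteq> S" and BS: "B \<subseteq> S"
  using finS by (auto simp: A_def B_def)

lemma a_pos: "0 < a" and b_pos: "0 < b" and a_le: "a \<le> 1" and b_le: "b \<le> 1"
  using xp_pos x_le pV by (auto simp: a_def b_def)

lemma xS: "u \<in> S \<Longrightarrow> 0 < x u" "u \<in> S \<Longrightarrow> x u \<le> 1"
  using x_pos x_le SV by auto

lemma nbrs_inner:
  assumes "0 < i" "i < L"
  shows "E `` {p i} = {u \<in> S. (p i, u) \<in> E} \<union> {p (i - 1), p (Suc i)}"
proof -
  have "{j. j \<le> L \<and> (j = Suc i \<or> i = Suc j)} = {i - 1, Suc i}" using assms by auto
  then show ?thesis using nbrs_path[of i] assms by simp
qed

lemma eq_inner: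
  assumes "0 < i" "i < L"
  shows "(q - 2 - card {u \<in> S. (p i, u) \<in> E}) * x (p i) = x (p (i - 1)) + x (p (Suc i)) + sum x {u \<in> S. (p i, u) \<in> E}"
proof -
  let ?C = "{u \<in> S. (p i, u) \<in> E}"
  have ne: "p (i - 1) \<noteq> p (Suc i)" using assms by (simp add: p_eq_iff)
  have disj: "?C \<inter> {p (i - 1), p (Suc i)} = {}" using p_notin_S[of "i - 1"] p_notin_S[of "Suc i"] assms by auto
  have "card (?C \<union> {p (i - 1), p (Suc i)}) = card ?C + 2"
    using ne disj finS by (subst card_Un_disjoint) auto
  moreover have "sum x (?C \<union> {p (i - 1), p (Suc i)}) = sum x ?C + (x (p (i - 1)) + x (p (Suc i)))"
    using ne disj finS by (subst sum.union_disjoint) auto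
  ultimately show ?thesis
    using eigen_eq[OF pV, of i] assms unfolding nbrs_inner[OF assms] by (simp add: algebra_simps)
qed

lemma eq_b: "(q - 2 - card B) * b = a + 1 + sum x B"
proof -
  have "Suc (L - 1) = L" "L - 1 - 1 = L - 2" using L_ge by auto
  then show ?thesis using eq_inner[of "L - 1"] L_ge x_top by (simp add: a_def b_def B_def)
qed

lemma eq_a: "(q - 2 - card A) * a = x (p (L - 3)) + b + sum x A"
proof -
  have "Suc (L - 2) = L - 1" "L - 2 - 1 = L - 3" using L_ge by auto
  then show ?thesis using eq_inner[of "L - 2"] L_ge by (simp add: a_def b_def A_def)
qed

lemma eq_top: "q - (real M + 1) = b + sum x S"
proof -
  have "p (L - 1) \<notin> S" using p_notin_S by simp
  then show ?thesis
    using eigen_eq[OF pV, of L] finS cardS x_top unfolding nbrs_top_eq by (simp add: b_def)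
qed

lemma growth_initial:
  assumes "i < L - 2"
  shows "x (p (Suc i)) = growth q i * x (p i)"
proof (rule pendant_path_growth[where x = "\<lambda>i. x (p i)", OF _ _ _ assms])
  have none: "{u \<in> S. (p i, u) \<in> E} = {}" if "i < L - 2" for i using not_adj_S[of i] that by auto
  have "{j. j \<le> L \<and> (j = Suc 0 \<or> 0 = Suc j)} = {Suc 0}" using L_ge by auto
  then have "E `` {p 0} = {p (Suc 0)}" using nbrs_path[of 0] none[of 0] L_ge by simp
  then show "q * x (p 0) = x (p 0) + x (p (Suc 0))" using eigen_eq[OF pV, of 0] by simp
  show "q * x (p i) = 2 * x (p i) + x (p (i - 1)) + x (p (Suc i))" if "0 < i" "i < L - 2" for i
  proof -
    have "(q - 2) * x (p i) = x (p (i - 1)) + x (p (Suc i))"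
      using eq_inner[of i] none[OF that(2)] that by simp
    then show ?thesis by (simp add: algebra_simps)
  qed
qed (use xp_pos in auto)

lemma a_eq: "a = path_growth q (L - 2) * x (p 0)"
  unfolding a_def by (rule path_growth_eq[where x = "\<lambda>i. x (p i)"]) (rule growth_initial)

text \<open>On a pendant path the left side would be the next entry \<open>b\<close>; the remaining
  terms are the contribution of the edges to \<open>A\<close>.\<close>

lemma growth_a: "growth q (L - 2) * a = b + card A * a + sum x A"
proof -
  have L: "L - 2 = Suc (L - 3)" using L_ge by simp
  have "a = growth q (L - 3) * x (p (L - 3))"
    using growth_initial[of "L - 3"] L_ge by (simp add: a_def L)
  then have "a / growth q (L - 3) = x (p (L - 3))" using growth_pos[OF q_ge_4, of "L - 3"] by simp
  then have "growth q (L - 2) * a = (q - 2) * a - x (p (L - 3))"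
    unfolding L by (simp add: algebra_simps)
  then show ?thesis using eq_a by (simp add: algebra_simps)
qed

text \<open>Comparison with \<open>P\<^bsub>L\<^esub> \<cdot> K\<^bsub>M+2\<^esub>\<close>.\<close>

lemma key_bound: "(b + card A * a + sum x A) * ((2 * real M + 2) / q) ^ (L - 1) \<le> 1"
proof -
  have L: "L - 1 = Suc (L - 2)" using L_ge by simp
  have "path_growth q (L - 1) * ((2 * real M + 2) / q) ^ (L - 1) \<le> path_growth (2 * real M + 2) (L - 1)"
    using q_le by (intro path_growth_scale_le[OF q_ge_4]) simp
  also have "\<dots> \<le> 1 / x (p 0)" using M_ge L_ge by (intro ratio_ge_kite[of "M + 2"]) auto
  finally have "path_growth q (L - 1) * ((2 * real M + 2) / q) ^ (L - 1) * x (p 0) \<le> 1"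
    using xp_pos[of 0] by (simp add: field_simps)
  moreover have "path_growth q (L - 1) * x (p 0) = b + card A * a + sum x A"
    using growth_a a_eq unfolding L by (simp add: mult_ac)
  ultimately show ?thesis by (metis mult.assoc mult.commute)
qed

text \<open>The shortfall of \<open>q\<close> from its upper bound; by the equation at
  \<open>p L\<close> it is the total shortfall of the neighbours of \<open>p L\<close> from
  1.\<close>

definition \<delta> :: real where "\<delta> = 2 * real M + 2 - q"

lemma \<delta>_eq: "\<delta> = (\<Sum>u\<in>S. 1 - x u) + (1 - b)"
  using eq_top cardS by (simp add: \<delta>_def sum_subtractf)

lemma \<delta>_bounds: "1 - b \<le> \<delta>" "0 \<le> \<delta>" "\<delta> < 2"
proof -
  have "0 \<le> (\<Sum>u\<in>S. 1 - x u)" using xS by (intro sum_nonneg) auto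
  then show "1 - b \<le> \<delta>" "0 \<le> \<delta>" using \<delta>_eq b_le by auto
  show "\<delta> < 2" using q_gt by (simp add: \<delta>_def)
qed

lemma q_bounds: "2 * real M < q" "q \<le> 2 * real M + 2"
  using q_gt q_le by auto

text \<open>The base is \<open>1 + \<delta> / q\<close>, and \<open>L_gt\<close> gives
  \<open>L - 1 \<ge> 900 * q\<close>.\<close>

lemma bernoulli_bound: "1 + 900 * \<delta> \<le> ((2 * real M + 2) / q) ^ (L - 1)"
proof -
  have "900 * (2 * real M + 2) \<le> 1000 * (2 * real M - 5) - 1" using M_ge by simp
  then have "900 * q \<le> real (L - 1)" using L_gt q_bounds M_ge L_ge by (simp add: of_nat_diff)
  then have "900 * q * (\<delta> / q) \<le> real (L - 1) * (\<delta> / q)"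
    using \<delta>_bounds q_ge_4 by (intro mult_right_mono) auto
  then have "900 * \<delta> \<le> real (L - 1) * (\<delta> / q)" using q_ge_4 by simp
  moreover have "1 + real (L - 1) * (\<delta> / q) \<le> (1 + \<delta> / q) ^ (L - 1)"
    by (rule Bernoulli_inequality) (use \<delta>_bounds q_ge_4 in \<open>simp add: order_trans[of _ 0]\<close>)
  moreover have "1 + \<delta> / q = (2 * real M + 2) / q" using q_ge_4 by (simp add: \<delta>_def field_simps)
  ultimately show ?thesis by simp
qed

lemma key_linear: "(b + card A * a + sum x A) * (1 + 900 * \<delta>) \<le> 1"
proof -
  have "0 \<le> sum x A" using xS AS by (intro sum_nonneg) (auto intro: less_imp_le)
  then have "0 \<le> b + card A * a + sum x A" using a_pos b_pos by simp
  then have "(b + card A * a + sum x A) * (1 + 900 * \<delta>)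
      \<le> (b + card A * a + sum x A) * ((2 * real M + 2) / q) ^ (L - 1)"
    by (intro mult_left_mono bernoulli_bound)
  then show ?thesis using key_bound by linarith
qed

lemma sum_A_nonneg: "0 \<le> sum x A"
  using xS AS by (intro sum_nonneg) (auto intro: less_imp_le)

text \<open>If \<open>b = 1\<close>, then all entries on \<open>S\<close> are \<open>1\<close> and the equation at \<open>p (L - 1)\<close> makes \<open>a\<close> an
  integer, but \<open>0 < a < 1\<close>.\<close>

lemma b_neq_1: "b \<noteq> 1"
proof
  assume b: "b = 1"
  have "0 \<le> card A * a" using a_pos by simp
  then have "b * (1 + 900 * \<delta>) \<le> (b + card A * a + sum x A) * (1 + 900 * \<delta>)"
    using sum_A_nonneg \<delta>_bounds by (intro mult_right_mono) auto
  then have "b * (1 + 900 * \<delta>) \<le> 1" using key_linear by linarith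
  then have "\<delta> = 0" using b \<delta>_bounds by simp
  then have "card A * a + sum x A \<le> 0" using key_linear b by simp
  then have A0: "card A * a = 0" "sum x A = 0" using sum_A_nonneg \<open>0 \<le> card A * a\<close> by linarith+
  have q: "q = 2 * real M + 2" using \<open>\<delta> = 0\<close> by (simp add: \<delta>_def)
  have "(\<Sum>u\<in>S. 1 - x u) = 0" using \<delta>_eq \<open>\<delta> = 0\<close> b by simp
  then have "\<forall>u\<in>S. 1 - x u = 0" using finS xS by (subst (asm) sum_nonneg_eq_0_iff) auto
  then have "sum x B = card B" using BS by (simp add: subset_iff)
  then have "real (2 * M) - real (2 * card B + 1) = a" using eq_b b q by (simp add: algebra_simps)
  then have "0 < int (2 * M) - int (2 * card B + 1)" "a = real_of_int (int (2 * M) - int (2 * card B + 1))"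
    using a_pos by auto
  then have "1 \<le> a" by linarith
  moreover have "growth q (L - 2) * a = 1" using growth_a A0 b by simp
  moreover have "1 < growth q (L - 2)" using growth_ge[OF q_ge_4, of "L - 2"] q_bounds M_ge by simp
  ultimately have "1 * 1 < growth q (L - 2) * a" by (intro mult_less_le_imp_less) auto
  then show False using \<open>growth q (L - 2) * a = 1\<close> by simp
qed

text \<open>\<open>\<delta> \<ge> 1 - b\<close> turns \<open>key_linear\<close> into
  \<open>900 * b * (1 - b) \<le> 1 - b\<close>, so \<open>b\<close> is either 1 or tiny.\<close>

lemma b_small: "900 * b \<le> 1"
proof -
  have "0 < 1 - b" using b_le b_neq_1 by simp
  have "0 \<le> card A * a" using a_pos by simp
  then have "b * (1 + 900 * \<delta>) \<le> (b + card A * a + sum x A) * (1 + 900 * \<delta>)"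
    using sum_A_nonneg \<delta>_bounds by (intro mult_right_mono) auto
  moreover have "b * (1 + 900 * (1 - b)) \<le> b * (1 + 900 * \<delta>)"
    using \<delta>_bounds b_pos by (intro mult_left_mono) auto
  ultimately have "900 * b * (1 - b) \<le> 1 * (1 - b)" using key_linear by (simp add: algebra_simps)
  then show ?thesis using \<open>0 < 1 - b\<close> by simp
qed

text \<open>The total shortfall on \<open>S\<close> is \<open>\<delta> - (1 - b)\<close>, which is
  below \<open>1 + b\<close> because \<open>\<delta> < 2\<close>.\<close>

lemma deficiency:
  assumes "C \<subseteq> S" shows "card C - (1 + b) \<le> sum x C"
proof -
  have "(\<Sum>u\<in>C. 1 - x u) \<le> (\<Sum>u\<in>S. 1 - x u)" using assms finS xS by (intro sum_mono2) auto
  then show ?thesis using \<delta>_eq \<delta>_bounds by (simp add: sum_subtractf)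
qed

text \<open>\<open>key_linear\<close> gives \<open>sum x A \<le> 1\<close>, while entries on
  \<open>S\<close> are close to 1 on average.\<close>

lemma card_A_le: "card A \<le> 2"
proof -
  have "(b + card A * a + sum x A) * 1 \<le> (b + card A * a + sum x A) * (1 + 900 * \<delta>)"
    using sum_A_nonneg \<delta>_bounds a_pos b_pos by (intro mult_left_mono) auto
  moreover have "0 \<le> card A * a" using a_pos by simp
  ultimately have "sum x A \<le> 1" using key_linear b_pos by simp
  then have "real (card A) < 3" using deficiency[OF AS] b_small by simp
  then show ?thesis by simp
qed

text \<open>In the equation at \<open>p (L - 1)\<close>, the neighbours in \<open>B\<close>
  contribute almost \<open>card B\<close>, but the left side is at most \<open>q * b\<close>, hence
  a small fraction of \<open>M\<close>.\<close>

lemma card_B_le: "400 * real (card B) \<le> M"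
proof -
  have "a + 1 + (real (card B) - (1 + b)) \<le> (q - 2 - card B) * b"
    using eq_b deficiency[OF BS] by simp
  then have "card B + card B * b \<le> (q - 1) * b" using a_pos by (simp add: algebra_simps)
  moreover have "0 \<le> card B * b" using b_pos by simp
  moreover have "(q - 1) * (900 * b) \<le> (q - 1) * 1" using b_small q_ge_4 by (intro mult_left_mono) auto
  then have "900 * ((q - 1) * b) \<le> q - 1" by (simp add: algebra_simps)
  moreover have "2000 \<le> real M" using M_ge by simp
  ultimately show ?thesis using q_bounds by linarith
qed


section \<open>The near-clique formed by \<open>S\<close> and the top of the path\<close>

definition T :: "'a set" where "T = insert (p L) S"
definition Z :: "'a \<Rightarrow> 'a set" where "Z u = T - {u} - E `` {u}"

lemma finT: "finite T" and cardT: "card T = M + 1" and TV: "T \<subseteq> V" and sumT: "sum x T = 1 + sum x S"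
  using finS cardS SV pV p_notin_S[of L] x_top by (auto simp: T_def)

lemma nbrs_out:
  assumes "u \<in> T"
  shows "E `` {u} - T = (if u \<in> A then {p (L - 2)} else {}) \<union> (if u \<in> insert (p L) B then {p (L - 1)} else {})"
proof -
  have notT: "p (L - 2) \<notin> T" "p (L - 1) \<notin> T"
    using p_notin_S[of "L - 2"] p_notin_S[of "L - 1"] L_ge by (auto simp: T_def p_eq_iff)
  show ?thesis
  proof (cases "u = p L")
    case True
    then have "u \<notin> A" using p_notin_S[of L] AS by auto
    then show ?thesis using True nbrs_top_eq notT by (auto simp: T_def)
  next
    case False
    then have u: "u \<in> S" using assms by (simp add: T_def)
    have "v = p (L - 2) \<and> u \<in> A \<or> v = p (L - 1) \<and> u \<in> B" if "(u, v) \<in> E" "v \<notin> T" for v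
    proof -
      have "v \<in> p ` {..L}" using that edgeD(2)[of u v] by (auto simp: T_def S_def)
      then obtain i where i: "v = p i" "i \<le> L" by auto
      then have "i \<noteq> L" using that by (auto simp: T_def)
      moreover have "(p i, u) \<in> E" using that symE i by (auto dest: symD)
      then have "\<not> i + 2 < L" using not_adj_S[of i u] u by auto
      ultimately have "i = L - 2 \<or> i = L - 1" using i(2) by linarith
      then show ?thesis using \<open>(p i, u) \<in> E\<close> u i by (auto simp: A_def B_def)
    qed
    moreover have "(u, p (L - 2)) \<in> E" if "u \<in> A" using that symE by (auto simp: A_def dest: symD)
    moreover have "(u, p (L - 1)) \<in> E" if "u \<in> B" using that symE by (auto simp: B_def dest: symD)
    ultimately show ?thesis using False notT by (auto split: if_splits)
  qed
qed

text \<open>Upper bound for the weight of the arcs leaving \<open>T\<close>: those from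
  \<open>p L\<close> and \<open>B\<close> to \<open>p (L - 1)\<close>, and those from
  \<open>A\<close> to \<open>p (L - 2)\<close>.\<close>

definition excess :: real where "excess = (1 + card B) * (1 + b) + card A * (1 + a)"

lemma sum_out_le: "(\<Sum>u\<in>T. \<Sum>v\<in>E `` {u} - T. x u + x v) \<le> excess"
proof -
  have ne: "p (L - 2) \<noteq> p (L - 1)" using L_ge by (simp add: p_eq_iff)
  have sub: "A \<subseteq> T" "insert (p L) B \<subseteq> T" using AS BS by (auto simp: T_def)
  have "(\<Sum>u\<in>T. \<Sum>v\<in>E `` {u} - T. x u + x v)
      = (\<Sum>u\<in>T. (if u \<in> A then x u + a else 0) + (if u \<in> insert (p L) B then x u + b else 0))"
    using ne by (intro sum.cong) (auto simp: nbrs_out a_def b_def)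
  also have "\<dots> = (\<Sum>u\<in>A. x u + a) + (\<Sum>u\<in>insert (p L) B. x u + b)"
    using sub finT by (simp only: sum.distrib sum.inter_restrict[symmetric] Int_absorb1)
  also have "\<dots> \<le> (\<Sum>u\<in>A. 1 + a) + (\<Sum>u\<in>insert (p L) B. 1 + b)"
    using sub TV x_le by (intro add_mono sum_mono add_right_mono) blast+
  also have "\<dots> = excess"
  proof -
    have "p L \<notin> B" using BS p_notin_S[of L] by auto
    then show ?thesis using finB by (simp add: excess_def)
  qed
  finally show ?thesis .
qed

text \<open>Sum the eigenvalue equations over \<open>T\<close> and compare with the complete graph on \<open>T\<close>.\<close>

lemma excess_ge: "(q - 2 * M) * sum x T + (\<Sum>u\<in>T. \<Sum>v\<in>Z u. x u + x v) \<le> excess"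
proof -
  have "q * sum x T = (\<Sum>u\<in>T. \<Sum>v\<in>E `` {u}. x u + x v)"
    unfolding sum_distrib_left using ep TV by (intro sum.cong) (auto simp: signless_eigenpair_def)
  also have "\<dots> = (\<Sum>u\<in>T. (\<Sum>v\<in>T - {u}. x u + x v) - (\<Sum>v\<in>Z u. x u + x v) + (\<Sum>v\<in>E `` {u} - T. x u + x v))"
  proof (intro sum.cong refl)
    fix u assume "u \<in> T"
    have "u \<notin> E `` {u}" using irreflE by (auto simp: irrefl_def)
    then have "E `` {u} = (T - {u} - Z u) \<union> (E `` {u} - T)" "Z u \<subseteq> T - {u}" by (auto simp: Z_def)
    then have "(\<Sum>v\<in>E `` {u}. x u + x v) = (\<Sum>v\<in>T - {u} - Z u. x u + x v) + (\<Sum>v\<in>E `` {u} - T. x u + x v)"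
      using finT finN by (subst sum.union_disjoint[symmetric]) auto
    also have "(\<Sum>v\<in>T - {u} - Z u. x u + x v) = (\<Sum>v\<in>T - {u}. x u + x v) - (\<Sum>v\<in>Z u. x u + x v)"
      using finT \<open>Z u \<subseteq> T - {u}\<close> by (intro sum_diff) auto
    finally show "(\<Sum>v\<in>E `` {u}. x u + x v) =
        (\<Sum>v\<in>T - {u}. x u + x v) - (\<Sum>v\<in>Z u. x u + x v) + (\<Sum>v\<in>E `` {u} - T. x u + x v)" .
  qed
  also have "\<dots> = 2 * (real (card T) - 1) * sum x T - (\<Sum>u\<in>T. \<Sum>v\<in>Z u. x u + x v)
      + (\<Sum>u\<in>T. \<Sum>v\<in>E `` {u} - T. x u + x v)"
    using sum_pairs[OF finT, of x] by (simp add: sum.distrib[of _ _ T] sum_subtractf)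
  finally show ?thesis using sum_out_le cardT by (simp add: algebra_simps)
qed

lemma excess_le: "excess \<le> M / 300 + 10"
proof -
  have "(1 + real (card B)) * (1 + b) \<le> (1 + real (card B)) * (901 / 900)"
    using b_small by (intro mult_left_mono) auto
  moreover have "real (card A) * (1 + a) \<le> 2 * 2" using card_A_le a_le a_pos by (intro mult_mono) auto
  ultimately show ?thesis using card_B_le by (simp add: excess_def)
qed

lemma sum_T_ge: "M - b \<le> sum x T"
  using deficiency[of S] sumT cardS by simp

lemma sum_Z_nonneg: "u \<in> T \<Longrightarrow> 0 \<le> (\<Sum>v\<in>Z u. x u + x v)"
  using TV by (intro sum_nonneg add_nonneg_nonneg less_imp_le x_pos) (auto simp: Z_def)

lemma \<theta>_le: "(q - 2 * M) * sum x T \<le> excess"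
proof -
  have "0 \<le> (\<Sum>u\<in>T. \<Sum>v\<in>Z u. x u + x v)" by (intro sum_nonneg sum_Z_nonneg)
  then show ?thesis using excess_ge by simp
qed

lemma sum_T_subset:
  assumes "C \<subseteq> T" shows "card C - (1 + b) \<le> sum x C"
proof (cases "p L \<in> C")
  case True
  have "finite C" using assms finT finite_subset by blast
  moreover have "C - {p L} \<subseteq> S" using assms by (auto simp: T_def)
  then have "card (C - {p L}) - (1 + b) \<le> sum x (C - {p L})" by (rule deficiency)
  ultimately show ?thesis
    using True x_top sum.remove[of C "p L" x] card_Suc_Diff1[of C "p L"] by simp
next
  case False
  then show ?thesis using assms by (intro deficiency) (auto simp: T_def)
qed

text \<open>By \<open>excess_ge\<close> the edges missing at \<open>u\<close> weigh at most
  \<open>excess\<close>, and the entries on \<open>Z u\<close> sum to nearly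
  \<open>card (Z u)\<close>.\<close>

lemma card_Z_le:
  assumes u: "u \<in> T" shows "real (card (Z u)) \<le> M / 300 + 12"
proof -
  have "(\<Sum>v\<in>Z u. x u + x v) \<le> (\<Sum>u\<in>T. \<Sum>v\<in>Z u. x u + x v)"
    by (rule member_le_sum[OF u sum_Z_nonneg finT]) auto
  moreover have "0 \<le> (q - 2 * M) * sum x T"
    using q_bounds TV x_pos by (intro mult_nonneg_nonneg sum_nonneg) (auto intro: less_imp_le)
  ultimately have "(\<Sum>v\<in>Z u. x u + x v) \<le> excess" using excess_ge by simp
  moreover have "0 \<le> card (Z u) * x u" using u TV x_pos[of u] by auto
  moreover have "card (Z u) - (1 + b) \<le> sum x (Z u)" by (rule sum_T_subset) (auto simp: Z_def)
  ultimately show ?thesis using excess_le b_le by (simp add: sum.distrib)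
qed

text \<open>\<open>u\<close> is adjacent to all but few vertices of \<open>T\<close>, whose entries
  sum to nearly \<open>M\<close>. Its equation becomes
  \<open>card C - 2 \<le> (q - card C) * x u\<close>, where both coefficients are close to
  \<open>M\<close>.\<close>

lemma x_S_ge:
  assumes u: "u \<in> S" shows "1 / 2 \<le> x u"
proof -
  have uT: "u \<in> T" "u \<in> V" using u SV by (auto simp: T_def)
  define C where "C = T - {u} - Z u"
  have C: "C \<subseteq> E `` {u}" "C \<subseteq> T" by (auto simp: C_def Z_def)
  have "Z u \<subseteq> T - {u}" by (auto simp: Z_def)
  then have "card C = card (T - {u}) - card (Z u)" "card (Z u) \<le> card (T - {u})"
    using finT by (auto simp: C_def card_Diff_subset finite_subset intro: card_mono)
  then have cC: "real (card C) = M - real (card (Z u))" using uT finT cardT by simp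
  have "(\<Sum>v\<in>C. x u + x v) \<le> (\<Sum>v\<in>E `` {u}. x u + x v)"
    using C x_pos uT edgeD by (intro sum_mono2 finN) (auto intro!: add_nonneg_nonneg intro: less_imp_le)
  also have "\<dots> = q * x u" using ep uT by (simp add: signless_eigenpair_def)
  finally have "card C * x u + sum x C \<le> q * x u" by (simp add: sum.distrib)
  then have "real (card C) - 2 \<le> (q - card C) * x u"
    using sum_T_subset[OF C(2)] b_le by (simp add: algebra_simps)
  moreover have "(q - card C) * x u \<le> (real M + 2 + real (card (Z u))) * x u"
    using cC q_bounds xS(1)[OF u] by (intro mult_right_mono) auto
  ultimately have *: "M - real (card (Z u)) - 2 \<le> (real M + 2 + real (card (Z u))) * x u" using cC by simp
  show ?thesis
  proof (rule ccontr)
    assume "\<not> 1 / 2 \<le> x u"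
    then have "(real M + 2 + real (card (Z u))) * x u \<le> (real M + 2 + real (card (Z u))) * (1 / 2)" by (intro mult_left_mono) auto
    with * have "M - real (card (Z u)) - 2 \<le> (real M + 2 + real (card (Z u))) * (1 / 2)" by (rule order_trans)
    then show False using card_Z_le[OF uT(1)] M_ge by simp
  qed
qed

lemma sum_ge_half: "C \<subseteq> S \<Longrightarrow> card C / 2 \<le> sum x C"
  using sum_mono[of C "\<lambda>_. 1 / 2" x] x_S_ge by auto

section \<open>Excluding edges between \<open>S\<close> and the path vertices below the top\<close>

lemma A_empty: "A = {}"
proof (rule ccontr)
  assume "A \<noteq> {}"
  then have "1 \<le> card A" using finA by (simp add: Suc_le_eq card_gt_0_iff)
  then have "1 / 2 \<le> sum x A" using sum_ge_half[OF AS] by simp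
  moreover have "0 \<le> card A * a" using a_pos by simp
  ultimately have "1 / 2 \<le> b + card A * a + sum x A" using b_pos by linarith
  moreover have "899 \<le> 1 + 900 * \<delta>" using \<delta>_bounds b_small by simp
  \<comment> \<open>A single vertex in \<open>A\<close> makes the first factor at least 1/2, but
    \<open>\<delta>\<close> is nearly 1 at least, so \<open>key_linear\<close> fails.\<close>
  ultimately have "1 / 2 * 899 \<le> (b + card A * a + sum x A) * (1 + 900 * \<delta>)"
    using b_pos by (intro mult_mono) auto
  then show False using key_linear by simp
qed

lemma growth_b: "growth q (L - 2) * a = b"
  using growth_a A_empty by simp

lemma b_eq: "b = path_growth q (L - 1) * x (p 0)"
proof -
  have L: "L - 1 = Suc (L - 2)" using L_ge by simp
  show ?thesis unfolding L using growth_b a_eq by (simp add: mult_ac)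
qed

lemma growth_top: "growth q (L - 1) * b = 1 + card B * b + sum x B"
proof -
  have L: "L - 1 = Suc (L - 2)" using L_ge by simp
  have "b / growth q (L - 2) = a" using growth_b growth_pos[OF q_ge_4, of "L - 2"] by (simp add: field_simps)
  then have "growth q (L - 1) * b = (q - 2) * b - a" unfolding L by (simp add: algebra_simps)
  then show ?thesis using eq_b by (simp add: algebra_simps)
qed

text \<open>Measures the cost of \<open>B\<close>: the ratio \<open>1 / x (p 0)\<close> falls short
  of \<open>path_growth q L\<close> by exactly this factor.\<close>

lemma path_growth_top: "path_growth q L * x (p 0) = 1 + card B * b + sum x B"
proof -
  have L: "L = Suc (L - 1)" using L_ge by simp
  have "path_growth q L = path_growth q (L - 1) * growth q (L - 1)" by (subst L) simp
  then show ?thesis using growth_top b_eq by (simp add: mult_ac)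
qed

text \<open>Comparison with \<open>P\<^bsub>L+1\<^esub> \<cdot> K\<^bsub>M+1\<^esub>\<close>.\<close>

lemma card_B_exp: "1 + card B / 2 \<le> exp (L * (q - 2 * M) / (2 * real M - 3))"
proof -
  have "path_growth q L \<le> path_growth (2 * real M) L * ((q - 3) / (2 * real M - 3)) ^ L"
    using q_bounds M_ge by (intro path_growth_le_scale) auto
  also have "\<dots> \<le> (1 / x (p 0)) * ((q - 3) / (2 * real M - 3)) ^ L"
    using M_ge q_bounds by (intro mult_right_mono ratio_ge_kite[of "M + 1"]) auto
  finally have "path_growth q L * x (p 0) \<le> (1 / x (p 0)) * ((q - 3) / (2 * real M - 3)) ^ L * x (p 0)"
    using xp_pos[of 0] by (intro mult_right_mono) auto
  then have "1 + card B * b + sum x B \<le> ((q - 3) / (2 * real M - 3)) ^ L"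
    using path_growth_top xp_pos[of 0] by simp
  also have "\<dots> \<le> exp (L * (q - 2 * M) / (2 * real M - 3))"
    using power_ratio_le_exp[of "2 * real M - 3" "q - 2 * M" L] q_bounds M_ge by simp
  finally have "1 + card B * b + sum x B \<le> exp (L * (q - 2 * M) / (2 * real M - 3))" .
  moreover have "0 \<le> card B * b" using b_pos by simp
  ultimately show ?thesis using sum_ge_half[OF BS] by linarith
qed

text \<open>With \<open>A\<close> empty, \<open>excess\<close> is nearly \<open>1 + card B\<close>
  and \<open>sum x T\<close> is nearly \<open>M\<close>. So each edge to \<open>B\<close> raises the
  eigenvalue only by order \<open>1 / M\<close>.\<close>

lemma \<theta>_bound: "q - 2 * M \<le> 2 * (1 + card B) / M"
proof -
  have "(q - 2 * M) * (M - b) \<le> (q - 2 * M) * sum x T"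
    using q_bounds sum_T_ge by (intro mult_left_mono) auto
  also have "\<dots> \<le> excess" by (rule \<theta>_le)
  also have "\<dots> \<le> (1 + card B) * (901 / 900)"
  proof -
    have "(1 + real (card B)) * (1 + b) \<le> (1 + real (card B)) * (901 / 900)"
      using b_small by (intro mult_left_mono) auto
    then show ?thesis by (simp add: excess_def A_empty)
  qed
  finally have "(q - 2 * M) * (M - b) \<le> (1 + card B) * (901 / 900)" .
  moreover have "(q - 2 * M) * (M * (2 / 3)) \<le> (q - 2 * M) * (M - b)"
    using q_bounds M_ge b_le by (intro mult_left_mono) auto
  moreover have "(q - 2 * M) * (M * (2 / 3)) = (q - 2 * M) * M * (2 / 3)" by simp
  ultimately have "(q - 2 * M) * M \<le> 2 * (1 + card B)" by linarith
  then show ?thesis using M_ge by (simp add: field_simps)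
qed

text \<open>The equation at \<open>p (L - 1)\<close> gives \<open>1 \<le> q * b\<close>, so
  \<open>key_bound\<close> yields \<open>(1 + y) ^ (L - 1) \<le> q\<close>. Taking logarithms bounds
  \<open>L\<close>, since \<open>\<delta> \<ge> 1 - b\<close> keeps \<open>y\<close> of order
  \<open>1 / q\<close>.\<close>

lemma L_le: "L \<le> 5 * q * ln q"
proof -
  define y where "y = \<delta> / q"
  have q0: "0 < q" using q_ge_4 by simp
  have y: "1 / (4 * q) \<le> y / 2" "0 \<le> y" "y \<le> 1 / 2"
    using \<delta>_bounds b_small q_bounds M_ge by (auto simp: y_def field_simps)
  have "1 \<le> (q - 2 - card B) * b" using eq_b a_pos xS(1) BS by (simp add: sum_nonneg subset_iff less_imp_le)
  also have "\<dots> \<le> q * b" using b_pos by (intro mult_right_mono) auto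
  finally have "1 \<le> q * b" .
  have "b * (1 + y) ^ (L - 1) \<le> 1"
    using key_bound A_empty q0 by (simp add: y_def \<delta>_def field_simps)
  have "(1 + y) ^ (L - 1) \<le> (q * b) * (1 + y) ^ (L - 1)"
    using \<open>1 \<le> q * b\<close> y mult_right_mono[of 1 "q * b" "(1 + y) ^ (L - 1)"] by simp
  also have "\<dots> \<le> q * 1"
    unfolding mult.assoc using \<open>b * _ \<le> 1\<close> q0 by (intro mult_left_mono) auto
  finally have "ln ((1 + y) ^ (L - 1)) \<le> ln q" using y q0 by (subst ln_le_cancel_iff) auto
  then have "(L - 1) * ln (1 + y) \<le> ln q" using y by (simp add: ln_realpow)
  moreover have "y - y\<^sup>2 \<le> ln (1 + y)" using y by (intro ln_one_plus_pos_lower_bound) auto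
  moreover have "y / 2 \<le> y - y\<^sup>2" using y mult_left_mono[of y "1/2" y] by (simp add: power2_eq_square)
  ultimately have "(L - 1) * (1 / (4 * q)) \<le> ln q"
    using y mult_left_mono[of "1 / (4 * q)" "ln (1 + y)" "real (L - 1)"] by simp
  then have "real (L - 1) \<le> 4 * (q * ln q)" using q0 by (simp add: field_simps)
  moreover have "1 \<le> ln q"
  proof -
    have "exp 1 \<le> q" using exp_le q_ge_4 by linarith
    then show ?thesis using q0 by (simp add: ln_ge_iff)
  qed
  then have "1 * 1 \<le> q * ln q" using q_ge_4 by (intro mult_mono) auto
  ultimately show ?thesis using L_ge by (simp add: of_nat_diff)
qed

text \<open>The bounds on \<open>L\<close> and on \<open>q - 2 * M\<close> turn
  \<open>card_B_exp\<close> into \<open>1 + \<beta> / 2 \<le> exp (c * (1 + \<beta>))\<close> with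
  \<open>c\<close> of order \<open>ln m / m\<close>. This is impossible for
  \<open>1 \<le> \<beta> \<le> m / 400\<close>.\<close>

lemma B_empty: "B = {}"
proof (rule ccontr)
  assume "B \<noteq> {}"
  then have \<beta>: "1 \<le> card B" using finB by (simp add: Suc_le_eq card_gt_0_iff)
  define m \<beta> where "m = real M" and "\<beta> = real (card B)"
  have m: "2000 \<le> m" using M_ge by (simp add: m_def)
  define c where "c = 30 * ln (3 * m) / m"
  have "0 \<le> c" using m by (simp add: c_def)
  have "q \<le> 3 * m" "0 < q" using q_bounds m by (auto simp: m_def)
  then have "5 * q * ln q \<le> 5 * (3 * m) * ln (3 * m)" using q_ge_4 by (intro mult_mono) auto
  then have "L \<le> 15 * m * ln (3 * m)" using L_le by simp
  then have "L * (q - 2 * m) \<le> 15 * m * ln (3 * m) * (2 * (1 + \<beta>) / m)"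
    using \<theta>_bound q_bounds m by (intro mult_mono) (auto simp: m_def \<beta>_def)
  also have "\<dots> = c * (1 + \<beta>) * m" using m by (simp add: c_def)
  also have "\<dots> \<le> c * (1 + \<beta>) * (2 * m - 3)"
    using m \<open>0 \<le> c\<close> by (intro mult_left_mono) (auto simp: \<beta>_def)
  finally have "L * (q - 2 * m) / (2 * m - 3) \<le> c * (1 + \<beta>)" using m by (simp add: divide_le_eq)
  then have *: "1 + \<beta> / 2 \<le> exp (c * (1 + \<beta>))"
    using card_B_exp by (simp add: m_def \<beta>_def) (meson exp_le_cancel_iff order_trans)
  have large: "60 * ln (3 * m) / sqrt m \<le> 3 / 10" "exp (c * (m / 400 + 1)) < sqrt m / 2"
    using large_M by (simp_all add: large_def m_def c_def)
  have sq: "1 \<le> sqrt m" "sqrt m * sqrt m = m" using m by auto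
  show False
  \<comment> \<open>Up to \<open>sqrt m\<close> the exponent is at most 3/10, so the right side
    stays below 3/2. Beyond it, the right side is below \<open>sqrt m / 2\<close>, roughly
    \<open>(3 * m)\<close> to the power 3/40.\<close>
  proof (cases "\<beta> \<le> sqrt m")
    case True
    have "c * (1 + \<beta>) \<le> c * (2 * sqrt m)" proof -
      have "1 + \<beta> \<le> 2 * sqrt m" using True sq by linarith
      then show ?thesis using \<open>0 \<le> c\<close> by (rule mult_left_mono)
    qed
    also have "\<dots> = 60 * ln (3 * m) / sqrt m"
    proof -
      have "sqrt m / m = 1 / sqrt m" using sq m by (simp add: field_simps)
      moreover have "c * (2 * sqrt m) = 60 * ln (3 * m) * (sqrt m / m)" by (simp add: c_def)
      ultimately show ?thesis by simp
    qed
    finally have "exp (c * (1 + \<beta>)) \<le> exp (3 / 10)" using large by simp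
    also have "\<dots> \<le> 1 + 3 / 10 + (3 / 10)\<^sup>2" by (rule exp_bound) auto
    also have "\<dots> < 1 + 1 / 2" by (simp add: power2_eq_square)
    finally show False using * \<beta> by (simp add: \<beta>_def)
  next
    case False
    have "1 + \<beta> \<le> m / 400 + 1" using card_B_le by (simp add: \<beta>_def m_def)
    then have "exp (c * (1 + \<beta>)) \<le> exp (c * (m / 400 + 1))" using \<open>0 \<le> c\<close> by (simp add: mult_left_mono)
    also have "\<dots> < sqrt m / 2" by (rule large)
    finally show False using * False by simp
  qed
qed

lemma pendant_path:
  assumes "i < L" "u \<in> S" shows "(p i, u) \<notin> E"
proof -
  consider "i + 2 < L" | "i = L - 2" | "i = L - 1" using assms by linarith
  then show ?thesis using not_adj_S[of i u] A_empty B_empty assms(2) by cases (auto simp: A_def B_def)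
qed

end

section \<open>From an extremal graph to the kite\<close>

lemma principal_ratio_geodesic:
  assumes G: "G \<in> connected_graphs n"
  obtains q x p L M where "geodesic_eigenpair {0..<n} (parcs G) q x p L M"
    "principal_ratio G = 1 / x (p 0)"
proof -
  let ?V = "{0..<n}" and ?E = "parcs G"
  have R: "0 < n" "?E \<subseteq> ?V \<times> ?V" "sym ?E" "irrefl ?E" "\<And>u v. u \<in> ?V \<Longrightarrow> v \<in> ?V \<Longrightarrow> (u, v) \<in> ?E\<^sup>*"
    using G by (auto simp: connected_graphs_iff)
  obtain q y where ep: "signless_eigenpair ?V ?E q y" and pr: "principal_ratio G = Max (y ` ?V) / Min (y ` ?V)"
    by (rule principal_ratio_eigenpair[OF G])
  have fin: "finite (y ` ?V)" "y ` ?V \<noteq> {}" using R(1) by simp_all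
  obtain u where u: "u \<in> ?V" "y u = Min (y ` ?V)" using Min_in[OF fin] by (metis imageE)
  obtain w where w: "w \<in> ?V" "y w = Max (y ` ?V)" using Max_in[OF fin] by (metis imageE)
  define m where "m = Max (y ` ?V)"
  have "0 < y w" using ep w(1) by (simp add: signless_eigenpair_def)
  then have "0 < m" using w(2) by (simp add: m_def)
  \<comment> \<open>Scaling the maximum to 1 makes the minimal entry the inverse of the
    ratio.\<close>
  define x where "x v = y v / m" for v
  obtain L p where p: "p 0 = u" "p L = w" "\<And>i. i < L \<Longrightarrow> (p i, p (Suc i)) \<in> ?E"
    "\<And>i j l. i \<le> L \<Longrightarrow> j \<le> L \<Longrightarrow> (p i, p j) \<in> ?E ^^ l \<Longrightarrow> j \<le> i + l"
    by (rule shortest_path_exists[OF R(5)[OF u(1) w(1)]]) (rule that)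
  have pV: "p i \<in> ?V" if "i \<le> L" for i
  proof (cases i)
    case (Suc j)
    then have "(p j, p i) \<in> ?E" using p(3)[of j] that by simp
    then show ?thesis using R(2) by blast
  qed (use p(1) u(1) in simp)
  have "inj_on p {..L}"
  proof (rule inj_onI)
    fix i j assume "i \<in> {..L}" "j \<in> {..L}" "p i = p j"
    then show "i = j" using p(4)[of i j 0] p(4)[of j i 0] by auto
  qed
  then have "L + 1 \<le> card ?V" using card_inj_on_le[of p "{..L}" ?V] pV by (simp add: image_subset_iff)
  then have card: "card ?V = L + 1 + (n - (L + 1))" by simp
  have "geodesic_eigenpair ?V ?E q x p L (n - (L + 1))"
  proof
    show "signless_eigenpair ?V ?E q x"
      using ep \<open>0 < m\<close>
      by (simp add: signless_eigenpair_def x_def flip: add_divide_distrib sum_divide_distrib)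
    show "x v \<le> 1" if "v \<in> ?V" for v
      using that \<open>0 < m\<close> by (simp add: x_def m_def)
    show "x (p L) = 1" using p(2) w \<open>0 < m\<close> by (simp add: x_def m_def)
  qed (fact finite_atLeastLessThan R p pV card | assumption)+
  moreover have "principal_ratio G = 1 / x (p 0)" using pr p(1) u(2) by (simp add: x_def m_def)
  ultimately show ?thesis by (rule that)
qed

context geodesic_eigenpair begin

text \<open>If \<open>M < m\<close>, then \<open>q - 1 \<le> 2 * m\<close> and the ratio is at most
  \<open>(2 * m) ^ L\<close>. A kite with half of its vertices in the clique does better, as its
  growth factors are at least \<open>(2 * m)\<^sup>2\<close>.\<close>

lemma many_vertices_off_path:
  assumes kites: "\<And>k s. 1 \<le> s \<Longrightarrow> k + s = L + 1 + M \<Longrightarrow>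
      \<exists>q'. 2 * (real s - 1) \<le> q' \<and> path_growth q' k \<le> 1 / x (p 0)"
    and n: "4 * m\<^sup>2 + 10 \<le> L + 1 + M"
  shows "m \<le> M"
proof (rule ccontr)
  assume "\<not> m \<le> M"
  define n where "n = L + 1 + M"
  define s where "s = n div 2"
  define k where "k = n - s"
  have ks: "1 \<le> s" "k + s = L + 1 + M" "n \<le> 2 * k" "L < n" using n by (auto simp: s_def k_def n_def)
  obtain q' where q': "2 * (real s - 1) \<le> q'" "path_growth q' k \<le> 1 / x (p 0)"
    using kites[OF ks(1,2)] by blast
  have "n \<le> 2 * s + 1" by (simp add: s_def)
  then have "4 * m\<^sup>2 + 10 \<le> 2 * s + 1" using n by (simp add: n_def)
  then have "real (4 * m\<^sup>2 + 10) \<le> real (2 * s + 1)" by (simp only: of_nat_le_iff)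
  then have s: "4 * (real m)\<^sup>2 + 10 \<le> 2 * real s + 1" by simp
  then have "(2 * real m)\<^sup>2 \<le> q' - 3" using q' by (simp add: power_mult_distrib)
  moreover have "4 \<le> q'" using q'(1) s zero_le_power2[of "real m"] by argo
  ultimately have "((2 * real m)\<^sup>2) ^ k \<le> path_growth q' k"
    using path_growth_ge[of q' k] power_mono[of "(2 * real m)\<^sup>2" "q' - 3" k] by simp
  also have "\<dots> \<le> (q - 1) ^ L" using q' ratio_le_power by linarith
  also have "\<dots> \<le> (2 * real m) ^ L"
  proof (cases "L = 0")
    case False
    then show ?thesis using q_gt_1 q_le \<open>\<not> m \<le> M\<close> by (intro power_mono) auto
  qed simp
  also have "\<dots> < (2 * real m) ^ (2 * k)"
    using \<open>\<not> m \<le> M\<close> ks by (intro power_strict_increasing) auto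
  finally show False by (simp add: power_mult)
qed

end

text \<open>Send \<open>p i\<close> to \<open>i\<close> and \<open>S\<close> to the clique vertices
  other than \<open>L\<close>. By \<open>pendant_path\<close> and \<open>p_edge_iff\<close>, every
  edge lands in the kite.\<close>

lemma (in extremal_eigenpair) bij_betw_kite:
  obtains h where "bij_betw h V {0..<L + Suc M}"
    "E \<subseteq> {(u, v). u \<in> V \<and> v \<in> V \<and> (h u, h v) \<in> parcs (kite (Suc L) (Suc M))}"
proof -
  have "card S = card {L + 1..<L + Suc M}" using cardS by simp
  then obtain g where g: "bij_betw g S {L + 1..<L + Suc M}"
    using finS finite_same_card_bij by blast
  define h where "h v = (if v \<in> S then g v else inv_into {..L} p v)" for v
  have hp: "h (p i) = i" if "i \<le> L" for i
    using that p_notin_S[OF that] inj_p by (simp add: h_def)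
  have hS: "h v \<in> {L + 1..<L + Suc M}" if "v \<in> S" for v
    using that bij_betwE[OF g] by (simp add: h_def)
  have "bij_betw h S {L + 1..<L + Suc M}"
    using g by (rule bij_betw_cong[THEN iffD1, rotated]) (simp add: h_def)
  moreover have "bij_betw h (p ` {..L}) {..L}"
    by (rule bij_betwI[of _ _ _ p]) (auto simp: hp)
  moreover have "{..L} \<inter> {L + 1..<L + Suc M} = {}" by auto
  ultimately have "bij_betw h (p ` {..L} \<union> S) ({..L} \<union> {L + 1..<L + Suc M})"
    by (intro bij_betw_combine)
  moreover have "{..L} \<union> {L + 1..<L + Suc M} = {0..<L + Suc M}" by auto
  ultimately have bij: "bij_betw h V {0..<L + Suc M}" using V_eq by simp
  let ?F = "parcs (kite (Suc L) (Suc M))"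
  have pS: "(h u, h v) \<in> ?F \<and> (h v, h u) \<in> ?F" if e: "(u, v) \<in> E" "u \<notin> S" "v \<in> S" for u v
  proof -
    have "u \<in> V" using e edgeD by blast
    then obtain i where i: "u = p i" "i \<le> L" using e(2) by (auto simp: S_def)
    then have "i = L" using pendant_path[of i v] e by (cases "i = L") auto
    then show ?thesis using i hp hS[OF e(3)] by (auto simp: parcs_kite)
  qed
  have "(h u, h v) \<in> ?F" if e: "(u, v) \<in> E" for u v
  proof -
    have uv: "u \<in> V" "v \<in> V" "u \<noteq> v" using e edgeD irreflE by (auto simp: irrefl_def)
    consider "u \<in> S" "v \<in> S" | "u \<in> S" "v \<notin> S" | "u \<notin> S" "v \<in> S" | "u \<notin> S" "v \<notin> S" by blast
    then show ?thesis
    proof cases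
      case 1
      have "h u \<noteq> h v" using bij uv by (auto simp: bij_betw_def dest: inj_onD)
      then show ?thesis using 1 hS[of u] hS[of v] by (simp add: parcs_kite)
    next
      case 2
      have "(v, u) \<in> E" using e symE by (auto dest: symD)
      then show ?thesis using 2 pS by blast
    next
      case 3
      then show ?thesis using e pS by blast
    next
      case 4
      then obtain i j where ij: "u = p i" "i \<le> L" "v = p j" "j \<le> L" using uv by (auto simp: S_def)
      then have "j = Suc i \<or> i = Suc j" using e p_edge_iff by blast
      then show ?thesis using ij hp by (auto simp: parcs_kite)
    qed
  qed
  then have "E \<subseteq> {(u, v). u \<in> V \<and> v \<in> V \<and> (h u, h v) \<in> ?F}" using EV by auto
  with bij show ?thesis by (rule that)
qed

theorem theorem1p1:
  shows "\<exists>N :: nat. \<forall>n \<ge> N. \<forall>G \<in> connected_graphs n.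
    (\<forall>H \<in> connected_graphs n. principal_ratio H \<le> principal_ratio G) \<longrightarrow>
    (\<exists>r s. r \<ge> 1 \<and> s \<ge> 1 \<and> r + s - 1 = n \<and> digraph_iso (with_proj G) (with_proj (kite r s)))"
proof -
  obtain c where c: "\<And>m. c \<le> m \<Longrightarrow> large m"
    using eventually_large by (auto simp: eventually_at_top_linorder)
  define m where "m = nat \<lceil>c\<rceil>"
  have "\<exists>r s. r \<ge> 1 \<and> s \<ge> 1 \<and> r + s - 1 = n \<and> digraph_iso (with_proj G) (with_proj (kite r s))"
    if n: "4 * m\<^sup>2 + 10 \<le> n" and G: "G \<in> connected_graphs n"
      and max: "\<forall>H \<in> connected_graphs n. principal_ratio H \<le> principal_ratio G" for n G
  proof -
    obtain q x p L M where geo: "geodesic_eigenpair {0..<n} (parcs G) q x p L M"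
      and pr: "principal_ratio G = 1 / x (p 0)"
      using principal_ratio_geodesic[OF G] by metis
    interpret geodesic_eigenpair "{0..<n}" "parcs G" q x p L M by (rule geo)
    have nLM: "n = L + 1 + M" using cardV by simp
    have kites: "\<exists>q'. 2 * (real s - 1) \<le> q' \<and> (0 < k \<longrightarrow> 2 * (real s - 1) < q') \<and> path_growth q' k \<le> 1 / x (p 0)"
      if "1 \<le> s" "k + s = L + 1 + M" for k s
    proof -
      have "kite (Suc k) s \<in> connected_graphs n" using kite_in_connected_graphs[OF that(1), of k] by (simp only: that(2) nLM)
      then show ?thesis using kite_eigenpair[OF that(1), of k] max pr by (metis order_trans)
    qed
    have "m \<le> M"
      by (rule many_vertices_off_path) (use kites n nLM in blast)+
    then have "large M" by (intro c) (simp add: m_def)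
    then interpret extremal_eigenpair "{0..<n}" "parcs G" q x p L M
      by unfold_locales (rule kites, assumption+)
    obtain h where h: "bij_betw h {0..<n} {0..<n}"
      "parcs G \<subseteq> {(u, v). u \<in> {0..<n} \<and> v \<in> {0..<n} \<and> (h u, h v) \<in> parcs (kite (Suc L) (Suc M))}"
      using bij_betw_kite nLM by auto
    let ?K = "kite (Suc L) (Suc M)"
    \<comment> \<open>The kite relabelled along \<open>h\<close> to the vertices of
      \<open>G\<close>.\<close>
    let ?F = "{(u, v). u \<in> {0..<n} \<and> v \<in> {0..<n} \<and> (h u, h v) \<in> parcs ?K}"
    have K: "?K \<in> connected_graphs n" using kite_in_connected_graphs[of "Suc M" L] nLM by simp
    then have KV: "parcs ?K \<subseteq> {0..<n} \<times> {0..<n}" "sym (parcs ?K)" "pverts ?K = {0..<n}"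
      by (auto simp: connected_graphs_iff)
    obtain q' y where y': "signless_eigenpair {0..<L + Suc M} (parcs ?K) q' y"
        "2 * (real (Suc M) - 1) \<le> q'" "path_growth q' L \<le> principal_ratio ?K"
      by (rule kite_eigenpair[of "Suc M" L]) (simp, rule that)
    have "L + Suc M = n" using nLM by simp
    then have y: "signless_eigenpair {0..<n} (parcs ?K) q' y" using y'(1) by simp
    have "path_growth q' L \<le> 1 / x (p 0)" using y'(3) max[rule_format, OF K] pr by simp
    \<comment> \<open>A proper subgraph of the kite would have a strictly smaller eigenvalue, so
      this inequality forces \<open>G\<close> to be the whole kite.\<close>
    then have "q' \<le> q" using y'(2) M_ge by (intro kite_le_q) auto
    moreover have "sym ?F" using KV(2) by (auto intro!: symI dest: symD)
    moreover have "{0..<n} \<noteq> {}" using nLM by simp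
    ultimately have EF: "parcs G = ?F"
      by (intro eigenvalue_subgraph_eq[OF ep signless_eigenpair_pullback[OF h(1) y KV(1)] _ _ h(2) _ symE]) blast+
    have "map_prod h h ` ?F = parcs ?K"
    proof
      show "parcs ?K \<subseteq> map_prod h h ` ?F"
      proof
        fix e assume e: "e \<in> parcs ?K"
        then obtain i j where ij: "e = (i, j)" "i \<in> {0..<n}" "j \<in> {0..<n}" using KV(1) by blast
        then have "i \<in> h ` {0..<n}" "j \<in> h ` {0..<n}" using h(1) by (simp_all add: bij_betw_def)
        then obtain u v where "e = (h u, h v)" "u \<in> {0..<n}" "v \<in> {0..<n}" using ij(1) by blast
        then show "e \<in> map_prod h h ` ?F" using e by (intro image_eqI[of _ _ "(u, v)"]) auto
      qed
    qed auto
    moreover have "pair_wf_digraph G" "pverts G = {0..<n}"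
    proof -
      show "pverts G = {0..<n}" using G by (simp add: connected_graphs_def)
      interpret pair_graph G using G by (simp add: connected_graphs_def)
      show "pair_wf_digraph G" by unfold_locales
    qed
    ultimately have "digraph_iso (with_proj G) (with_proj ?K)"
      using digraph_isoI[of G h ?K] h(1) KV(3) EF by simp
    then show ?thesis using nLM by (intro exI[of _ "Suc L"] exI[of _ "Suc M"]) auto
  qed
  then show ?thesis by blast
qed

end
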